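(* Let $n\geq 3$ be an integer. Then $fmp(G(2^n,4))=n$, and $fsmp(G(2^n,4))=n-1$ if $n\in\{3,4\}$, while $fsmp(G(2^n,4))=n$ otherwise.
   Context: The recursive circulant graph $G(2^n,4)$ has vertex set $\{0,1,\dots,2^n-1\}$, with $u,v$ adjacent iff $u-v\equiv\pm4^i\pmod{2^n}$ for some $0\leq i\leq\lceil n/2\rceil-1$; it is $n$-regular. A fractional perfect matching of $G$ is $g:E(G)\to[0,1]$ with $\sum_{e\ni v}g(e)=1$ for all $v$. $fmp(G)$ (resp. $fsmp(G)$) is the minimum size of a set $F\subseteq E(G)$ (resp. $F\subseteq V(G)\cup E(G)$) whose deletion (vertices with incident edges, and edges) leaves a graph with no fractional perfect matching. *)

theory Defs
  imports Complex_Main "HOL-Number_Theory.Cong"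
begin

text \<open>A graph is a pair of a vertex set and a set of edges, each edge being the set of its two
  end vertices.\<close>

type_synonym 'a ugraph = "'a set \<times> 'a set set"

abbreviation verts :: "'a ugraph \<Rightarrow> 'a set" where "verts G \<equiv> fst G"

abbreviation edges :: "'a ugraph \<Rightarrow> 'a set set" where "edges G \<equiv> snd G"

definition fractional_perfect_matching :: "'a ugraph \<Rightarrow> ('a set \<Rightarrow> real) \<Rightarrow> bool" where
  "fractional_perfect_matching G g \<longleftrightarrow>
     (\<forall>e\<in>edges G. 0 \<le> g e \<and> g e \<le> 1) \<and>
     (\<forall>v\<in>verts G. (\<Sum>e | e \<in> edges G \<and> v \<in> e. g e) = 1)"

definition has_fpm :: "'a ugraph \<Rightarrow> bool" where
  "has_fpm G \<longleftrightarrow> (\<exists>g. fractional_perfect_matching G g)"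

definition delete_edges :: "'a ugraph \<Rightarrow> 'a set set \<Rightarrow> 'a ugraph" where
  "delete_edges G F = (verts G, edges G - F)"

text \<open>A set of vertices and edges is a subset of the disjoint union \<open>verts G <+> edges G\<close>:
  \<open>Inl v\<close> stands for the vertex \<open>v\<close> and \<open>Inr e\<close> for the edge \<open>e\<close>.\<close>

definition delete_elems :: "'a ugraph \<Rightarrow> ('a + 'a set) set \<Rightarrow> 'a ugraph" where
  "delete_elems G F =
     ({v \<in> verts G. Inl v \<notin> F}, {e \<in> edges G. Inr e \<notin> F \<and> (\<forall>v\<in>e. Inl v \<notin> F)})"

text \<open>Both minima are over a nonempty set as soon as \<open>G\<close> is finite with at least one vertex
  (lemmas \<open>fmp_witness\<close> and \<open>fsmp_witness\<close>); otherwise the values carry no meaning.\<close>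

definition fmp :: "'a ugraph \<Rightarrow> nat" where
  "fmp G = (LEAST k. \<exists>F. finite F \<and> F \<subseteq> edges G \<and> card F = k \<and> \<not> has_fpm (delete_edges G F))"

definition fsmp :: "'a ugraph \<Rightarrow> nat" where
  "fsmp G =
     (LEAST k. \<exists>F. finite F \<and> F \<subseteq> verts G <+> edges G \<and> card F = k \<and> \<not> has_fpm (delete_elems G F))"

lemma fmp_witness:
  assumes "finite (edges G)" "verts G \<noteq> {}"
  shows "\<exists>k F. finite F \<and> F \<subseteq> edges G \<and> card F = k \<and> \<not> has_fpm (delete_edges G F)"
proof -
  have "\<not> has_fpm (delete_edges G (edges G))"
    using assms(2) by (auto simp: has_fpm_def fractional_perfect_matching_def delete_edges_def)
  then show ?thesis using assms(1) by blast
qed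

lemma fsmp_witness:
  assumes "finite (edges G)" "verts G \<noteq> {}"
  shows "\<exists>k F. finite F \<and> F \<subseteq> verts G <+> edges G \<and> card F = k \<and> \<not> has_fpm (delete_elems G F)"
proof -
  have "delete_elems G (Inr ` edges G) = (verts G, {})"
    by (auto simp: delete_elems_def)
  then have "\<not> has_fpm (delete_elems G (Inr ` edges G))"
    using assms(2) by (auto simp: has_fpm_def fractional_perfect_matching_def)
  moreover have "finite (Inr ` edges G)" "Inr ` edges G \<subseteq> verts G <+> edges G"
    using assms(1) by auto
  ultimately show ?thesis by blast
qed

text \<open>The recursive circulant graph $G(2^n,4)$. The vertices are integers, so that \<open>u - v\<close> is
  not truncated.\<close>

definition rec_circulant_adj :: "nat \<Rightarrow> int \<Rightarrow> int \<Rightarrow> bool" where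
  "rec_circulant_adj n u v \<longleftrightarrow>
     (\<exists>i::nat. int i \<le> \<lceil>real n / 2\<rceil> - 1 \<and>
        ([u - v = 4 ^ i] (mod 2 ^ n) \<or> [u - v = - (4 ^ i)] (mod 2 ^ n)))"

definition rec_circulant :: "nat \<Rightarrow> int ugraph" where
  "rec_circulant n =
     ({0..2 ^ n - 1},
      {{u, v} | u v. u \<in> {0..2 ^ n - 1} \<and> v \<in> {0..2 ^ n - 1} \<and> rec_circulant_adj n u v})"

lemma rec_circulant_adj_irrefl: "\<not> rec_circulant_adj n u u"
proof
  assume "rec_circulant_adj n u u"
  then obtain i :: nat where i: "int i \<le> \<lceil>real n / 2\<rceil> - 1"
    and c: "[0 = 4 ^ i] (mod (2 ^ n :: int)) \<or> [0 = - (4 ^ i)] (mod (2 ^ n :: int))"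
    by (auto simp: rec_circulant_adj_def)
  from c have "(2 ^ n :: int) dvd 4 ^ i"
    by (metis cong_0_iff cong_sym dvd_minus_iff)
  also have "(4 ^ i :: int) = 2 ^ (2 * i)"
    by (simp add: power_mult)
  finally have "n \<le> 2 * i"
    by (auto dest!: zdvd_imp_le intro: power_le_imp_le_exp)
  moreover have "2 * i < n"
    using i by linarith
  ultimately show False by simp
qed

lemma card_rec_circulant_edge: "e \<in> edges (rec_circulant n) \<Longrightarrow> card e = 2"
  using rec_circulant_adj_irrefl by (fastforce simp: rec_circulant_def card_2_iff)

end

theory Submission
  imports Defs
begin

text \<open>
  By Hall's theorem in the bipartite double cover, deleting vertices \<open>A\<close> and edges \<open>B\<close> destroys
  all fractional perfect matchings only if there are disjoint vertex sets \<open>S \<noteq> {}\<close> and \<open>U\<close>, the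
  latter including \<open>A\<close>, with \<open>|U| < |S| + |A|\<close>, such that every edge that meets \<open>S\<close> and misses \<open>U\<close>
  lies in \<open>B\<close>. Hence more than \<open>k\<close> deletions are needed as soon as
  \<open>|S| + k \<le> |U| + |{edges meeting S and missing U}|\<close> for all such \<open>S\<close> and \<open>U\<close>.

  This expansion property is inherited from \<open>G(2^n,4)\<close> by \<open>G(2^(n+2),4)\<close>, with \<open>k\<close> improved to
  \<open>min (k + 3) (n + 1)\<close>: the four residue classes mod 4 are copies of \<open>G(2^n,4)\<close>, and consecutive
  classes are joined by matchings taken from the Hamiltonian cycle of the edges \<open>{x, x + 1}\<close>. A class
  missed by \<open>S\<close> must pay for its neighbours in \<open>S\<close> along these matchings. The induction starts with
  \<open>k = 1\<close> for \<open>n = 3\<close> and \<open>k = 2\<close> for \<open>n = 4\<close>, where edge-disjoint 5-cycles \<open>x, x + 1, ..., x + 4\<close>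
  bound how close to bipartite the graph can be, and it reaches \<open>k = n - 1\<close> from \<open>n = 5\<close> on.

  If only edges are deleted and \<open>n\<close> is 3 or 4, double counting the edges at \<open>S\<close> and at \<open>U\<close>
  leaves an odd set \<open>S \<union> U\<close> with too few boundary edges.
\<close>

section \<open>Hall's condition and barriers\<close>

text \<open>Halmos-Vaughan induction. If a proper nonempty \<open>J\<close> is tight,
  \<open>J\<close> and \<open>X - J\<close> are matched separately, the latter outside the
  neighbours of \<open>J\<close>. Otherwise every such subset has a neighbour to spare, so an
  arbitrary pair \<open>a\<close>, \<open>b\<close> can be matched and removed.\<close>

theorem hall_marriage:
  assumes "finite X" "\<And>x. x \<in> X \<Longrightarrow> finite (N x)"
    and "\<And>J. J \<subseteq> X \<Longrightarrow> card J \<le> card (\<Union>(N ` J))"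
  shows "\<exists>f. inj_on f X \<and> (\<forall>x\<in>X. f x \<in> N x)"
  using assms
proof (induction X arbitrary: N rule: finite_psubset_induct)
  case (psubset X)
  note fin = psubset.prems(1) and hall = psubset.prems(2)
  have finU: "finite (\<Union>(N ` J))" if "J \<subseteq> X" for J
    using that fin psubset.hyps finite_subset by blast
  consider "X = {}" | (tight) J where "J \<subset> X" "J \<noteq> {}" "card (\<Union>(N ` J)) \<le> card J"
    | (loose) "X \<noteq> {}" "\<And>J. J \<subset> X \<Longrightarrow> J \<noteq> {} \<Longrightarrow> card J < card (\<Union>(N ` J))"
    by (meson not_le)
  then show ?case
  proof cases
    case 1
    then show ?thesis by simp
  next
    case tight
    let ?M = "\<lambda>x. N x - \<Union>(N ` J)"
    have finJ: "finite J"
      using tight(1) psubset.hyps by (meson finite_subset psubset_imp_subset)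
    have "\<exists>f. inj_on f J \<and> (\<forall>x\<in>J. f x \<in> N x)"
      using tight(1) fin hall by (intro psubset.IH) auto
    then obtain f where f: "inj_on f J" "\<And>x. x \<in> J \<Longrightarrow> f x \<in> N x"
      by blast
    have "\<exists>g. inj_on g (X - J) \<and> (\<forall>x\<in>X - J. g x \<in> ?M x)"
    proof (rule psubset.IH)
      fix K assume K: "K \<subseteq> X - J"
      then have "finite K"
        using psubset.hyps finite_subset by blast
      then have "card K + card J = card (K \<union> J)"
        using K finJ by (subst card_Un_disjoint) auto
      also have "\<dots> \<le> card (\<Union>(N ` (K \<union> J)))"
        using K tight(1) by (intro hall) auto
      also have "\<Union>(N ` (K \<union> J)) = \<Union>(?M ` K) \<union> \<Union>(N ` J)"
        by auto
      also have "card \<dots> \<le> card (\<Union>(?M ` K)) + card (\<Union>(N ` J))"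
        by (rule card_Un_le)
      finally show "card K \<le> card (\<Union>(?M ` K))"
        using tight(3) by linarith
    qed (use tight fin in auto)
    then obtain g where g: "inj_on g (X - J)" "\<And>x. x \<in> X - J \<Longrightarrow> g x \<in> ?M x"
      by blast
    let ?h = "\<lambda>x. if x \<in> J then f x else g x"
    have "inj_on ?h (J \<union> (X - J))"
      using f g by (intro inj_on_disjoint_Un) fastforce+
    then have "inj_on ?h X"
      using tight(1) by (simp add: Un_absorb1 psubset_imp_subset)
    moreover have "\<forall>x\<in>X. ?h x \<in> N x"
      using f g by auto
    ultimately show ?thesis by blast
  next
    case loose
    then obtain a where a: "a \<in> X" by blast
    have "N a \<noteq> {}"
      using hall[of "{a}"] a by auto
    then obtain b where b: "b \<in> N a" by blast
    let ?M = "\<lambda>x. N x - {b}"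
    have "\<exists>g. inj_on g (X - {a}) \<and> (\<forall>x\<in>X - {a}. g x \<in> ?M x)"
    proof (rule psubset.IH)
      fix K assume K: "K \<subseteq> X - {a}"
      show "card K \<le> card (\<Union>(?M ` K))"
      proof (cases "K = {}")
        case False
        then have "card K < card (\<Union>(N ` K))"
          using K a by (intro loose(2)) auto
        moreover have "\<Union>(?M ` K) = \<Union>(N ` K) - {b}" by auto
        ultimately show ?thesis
          by (auto simp: card_Diff_singleton_if)
      qed simp
    qed (use a fin in auto)
    then obtain g where g: "inj_on g (X - {a})" "\<And>x. x \<in> X - {a} \<Longrightarrow> g x \<in> ?M x"
      by blast
    have "inj_on (g(a := b)) X"
      using g by (auto simp: inj_on_def)
    moreover have "\<forall>x\<in>X. (g(a := b)) x \<in> N x"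
      using g b by auto
    ultimately show ?thesis by blast
  qed
qed

text \<open>For \<open>S\<close> and \<open>U\<close> to form a barrier, the deleted edges must
  include all of these.\<close>

definition free_edges :: "'a ugraph \<Rightarrow> 'a set \<Rightarrow> 'a set \<Rightarrow> 'a set set" where
  "free_edges G S U = {e \<in> edges G. e \<inter> S \<noteq> {} \<and> e \<inter> U = {}}"

definition simple_graph :: "'a ugraph \<Rightarrow> bool" where
  "simple_graph G \<longleftrightarrow> finite (verts G) \<and> (\<forall>e\<in>edges G. e \<subseteq> verts G \<and> card e = 2)"

lemma simple_graph_finite_edges: "simple_graph G \<Longrightarrow> finite (edges G)"
  unfolding simple_graph_def by (meson Pow_iff finite_Pow_iff finite_subset subsetI)

text \<open>Each edge \<open>{x, f x}\<close> gets weight 1/2 for every such \<open>x\<close>, hence weight 1 if \<open>f\<close> swaps its ends.\<close>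

lemma has_fpm_if_permutation:
  assumes G: "simple_graph G"
    and f: "inj_on f (verts G)" "\<And>x. x \<in> verts G \<Longrightarrow> {x, f x} \<in> edges G"
  shows "has_fpm G"
proof -
  let ?V = "verts G"
  define g where "g e = real (card {x \<in> ?V. e = {x, f x}}) / 2" for e
  have finV: "finite ?V" using G by (simp add: simple_graph_def)
  have fV: "f x \<in> ?V" "f x \<noteq> x" if "x \<in> ?V" for x
    using f(2)[OF that] G by (auto simp: simple_graph_def)
  have bij: "f ` ?V = ?V"
    using fV finV f(1) by (intro endo_inj_surj) auto
  have "g e \<le> 1" if e_edge: "e \<in> edges G" for e
  proof -
    obtain u v where e: "e = {u, v}"
      using e_edge G by (meson card_2_iff simple_graph_def)
    have "card {x \<in> ?V. e = {x, f x}} \<le> card {u, v}"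
      using e by (intro card_mono) auto
    also have "\<dots> \<le> 2" by (simp add: card_insert_if)
    finally show ?thesis by (simp add: g_def)
  qed
  moreover have "(\<Sum>e | e \<in> edges G \<and> v \<in> e. g e) = 1" if v: "v \<in> ?V" for v
  proof -
    \<comment> \<open>The half-weights at \<open>v\<close> come from exactly two vertices:
      \<open>v\<close> itself and its preimage \<open>w\<close> under \<open>f\<close>.\<close>
    obtain w where w: "w \<in> ?V" "f w = v" using v bij by (metis imageE)
    have finE: "finite {e \<in> edges G. v \<in> e}"
      using simple_graph_finite_edges[OF G] by simp
    have "(\<Sum>e | e \<in> edges G \<and> v \<in> e. card {x \<in> ?V. e = {x, f x}}) =
        card (\<Union>e\<in>{e \<in> edges G. v \<in> e}. {x \<in> ?V. e = {x, f x}})"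
      using finE finV by (subst card_UN_disjoint) auto
    also have "(\<Union>e\<in>{e \<in> edges G. v \<in> e}. {x \<in> ?V. e = {x, f x}}) = {v, w}"
      using v w f inj_onD[OF f(1)] by auto
    also have "card {v, w} = 2"
      using w fV(2) by auto
    finally show ?thesis
      by (simp add: g_def flip: sum_divide_distrib of_nat_sum)
  qed
  ultimately show ?thesis
    unfolding has_fpm_def fractional_perfect_matching_def
    by (intro exI[of _ g]) (auto simp: g_def)
qed

text \<open>Since the weights at each vertex add up to 1, the size of a vertex set is the sum over
  all edges of the weight times the number of ends in the set. The assumption compares these sums
  for \<open>S\<close> and \<open>T\<close> term by term.\<close>

lemma has_fpm_card_le:
  assumes G: "simple_graph G" and fpm: "has_fpm G"
    and ST: "S \<subseteq> verts G" "T \<subseteq> verts G"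
    and le: "\<And>e. e \<in> edges G \<Longrightarrow> card (e \<inter> S) \<le> card (e \<inter> T)"
  shows "card S \<le> card T"
proof -
  obtain g where g: "fractional_perfect_matching G g"
    using fpm by (auto simp: has_fpm_def)
  have finE: "finite (edges G)"
    by (rule simple_graph_finite_edges[OF G])
  have weight: "real (card X) = (\<Sum>e\<in>edges G. real (card (e \<inter> X)) * g e)" if X: "X \<subseteq> verts G" for X
  proof -
    have finX: "finite X"
      using X G finite_subset by (auto simp: simple_graph_def)
    have "real (card X) = (\<Sum>v\<in>X. \<Sum>e | e \<in> edges G \<and> v \<in> e. g e)"
      using g X by (simp add: fractional_perfect_matching_def subset_iff)
    also have "\<dots> = (\<Sum>e\<in>edges G. \<Sum>v | v \<in> X \<and> v \<in> e. g e)"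
      by (rule sum.swap_restrict[OF finX finE])
    also have "\<dots> = (\<Sum>e\<in>edges G. real (card (e \<inter> X)) * g e)"
      by (intro sum.cong) (auto simp: Int_def conj_commute)
    finally show ?thesis .
  qed
  have "real (card S) \<le> real (card T)"
    unfolding weight[OF ST(1)] weight[OF ST(2)] using g le
    by (intro sum_mono mult_right_mono) (auto simp: fractional_perfect_matching_def)
  then show ?thesis by simp
qed

lemma simple_graph_delete_elems: "simple_graph G \<Longrightarrow> simple_graph (delete_elems G F)"
  by (auto simp: simple_graph_def delete_elems_def)

lemma delete_edges_eq_delete_elems: "delete_edges G F = delete_elems G (Inr ` F)"
  by (auto simp: delete_edges_def delete_elems_def)

text \<open>From a violator \<open>X\<close> of Hall's condition with neighbourhood \<open>Y\<close> take \<open>S = X - Y\<close> and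
  \<open>U = Y - X\<close> plus the deleted vertices; no surviving edge joins \<open>X - Y\<close> to \<open>X\<close>.\<close>

lemma no_fpm_obtain_barrier:
  assumes G: "simple_graph G" and F: "F \<subseteq> verts G <+> edges G" "\<not> has_fpm (delete_elems G F)"
  obtains S U where "S \<subseteq> verts G" "U \<subseteq> verts G" "S \<inter> U = {}" "S \<noteq> {}"
    "card U < card S + card (Inl -` F)" "free_edges G S U \<subseteq> Inr -` F"
proof -
  let ?H = "delete_elems G F"
  define N where "N x = {y. {x, y} \<in> edges ?H}" for x
  have H: "simple_graph ?H"
    by (rule simple_graph_delete_elems[OF G])
  have finV: "finite (verts G)" "finite (verts ?H)"
    using G H by (auto simp: simple_graph_def)
  have NV: "N x \<subseteq> verts ?H" for x
    using H by (auto simp: simple_graph_def N_def)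
  have finN: "finite (N x)" for x
    using NV finV finite_subset by blast
  have "\<not> (\<forall>J \<subseteq> verts ?H. card J \<le> card (\<Union>(N ` J)))"
  proof
    assume "\<forall>J \<subseteq> verts ?H. card J \<le> card (\<Union>(N ` J))"
    then obtain f where "inj_on f (verts ?H)" "\<forall>x\<in>verts ?H. f x \<in> N x"
      using hall_marriage[of "verts ?H" N] finV finN by auto
    then have "has_fpm ?H"
      by (intro has_fpm_if_permutation[OF H]) (auto simp: N_def)
    with F show False by simp
  qed
  then obtain X where X: "X \<subseteq> verts ?H" "card (\<Union>(N ` X)) < card X"
    by (meson not_le)
  define Y where "Y = \<Union>(N ` X)"
  define A where "A = Inl -` F"
  have YV: "Y \<subseteq> verts ?H" using NV by (auto simp: Y_def)
  have "A \<subseteq> verts G" using F by (auto simp: A_def)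
  then have fin: "finite X" "finite Y" "finite A"
    using X(1) YV finV finite_subset by blast+
  have AV: "A \<subseteq> verts G" "verts ?H = verts G - A"
    using F by (auto simp: A_def delete_elems_def)
  show thesis
  proof (rule that[of "X - Y" "Y - X \<union> A"])
    show "X - Y \<subseteq> verts G" "Y - X \<union> A \<subseteq> verts G" "(X - Y) \<inter> (Y - X \<union> A) = {}"
      using X YV AV by auto
    \<comment> \<open>\<open>X\<close> and \<open>Y\<close> both lose the same part
      \<open>X \<inter> Y\<close>, so the deficiency of \<open>Y\<close> persists.\<close>
    have card: "card X = card (X - Y) + card (X \<inter> Y)" "card Y = card (Y - X) + card (X \<inter> Y)"
      using fin by (metis card_Diff_subset_Int card_Int_Diff inf.commute add.commute finite_Int)+
    then have lt: "card (Y - X) < card (X - Y)"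
      using X(2) by (simp add: Y_def)
    then show "X - Y \<noteq> {}" by (metis card.empty not_less_zero)
    have "card (Y - X \<union> A) \<le> card (Y - X) + card A" by (rule card_Un_le)
    then show "card (Y - X \<union> A) < card (X - Y) + card (Inl -` F)"
      using lt by (simp add: A_def)
    show "free_edges G (X - Y) (Y - X \<union> A) \<subseteq> Inr -` F"
    proof
      fix e assume "e \<in> free_edges G (X - Y) (Y - X \<union> A)"
      then have e: "e \<in> edges G" "e \<inter> (X - Y) \<noteq> {}" "e \<inter> (Y - X) = {}" "e \<inter> A = {}"
        by (auto simp: free_edges_def)
      from e(2) obtain x where x: "x \<in> e" "x \<in> X" "x \<notin> Y" by blast
      obtain y where y: "e = {x, y}"
        using e(1) x(1) G unfolding simple_graph_def card_2_iff by (metis doubleton_eq_iff insertE singletonD)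
      show "e \<in> Inr -` F"
      proof (rule ccontr)
        assume "e \<notin> Inr -` F"
        then have "e \<in> edges ?H"
          using e by (auto simp: delete_elems_def A_def)
        \<comment> \<open>A surviving edge puts \<open>y\<close> in \<open>Y\<close>, hence in
          \<open>X\<close>, because the edge misses \<open>Y - X\<close>. Then \<open>x\<close> is a
          neighbour of an element of \<open>X\<close>, against \<open>x \<notin> Y\<close>.\<close>
        then have "y \<in> N x" "x \<in> N y"
          using y by (auto simp: N_def insert_commute)
        then show False
          using e(3) x y by (auto simp: Y_def)
      qed
    qed
  qed
qed

section \<open>Recursive expansion\<close>

abbreviation circ_verts :: "nat \<Rightarrow> int set" where
  "circ_verts n \<equiv> {0..2 ^ n - 1}"

lemma verts_rec_circulant [simp]: "verts (rec_circulant n) = circ_verts n"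
  by (simp add: rec_circulant_def)

lemma rec_circulant_adj_iff:
  "rec_circulant_adj n u v \<longleftrightarrow>
     (\<exists>i. 2 * i < n \<and> ([u - v = 4 ^ i] (mod 2 ^ n) \<or> [u - v = - (4 ^ i)] (mod 2 ^ n)))"
proof -
  have "int i \<le> \<lceil>real n / 2\<rceil> - 1 \<longleftrightarrow> 2 * i < n" for i
    by linarith
  then show ?thesis by (simp add: rec_circulant_adj_def)
qed

lemma edge_rec_circulantI:
  "u \<in> circ_verts n \<Longrightarrow> v \<in> circ_verts n \<Longrightarrow> rec_circulant_adj n u v \<Longrightarrow> {u, v} \<in> edges (rec_circulant n)"
  by (auto simp: rec_circulant_def)

lemma simple_graph_rec_circulant: "simple_graph (rec_circulant n)"
  unfolding simple_graph_def using card_rec_circulant_edge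
  by (auto simp: rec_circulant_def)

lemma finite_free_edges_rec_circulant: "finite (free_edges (rec_circulant n) S U)"
  using simple_graph_finite_edges[OF simple_graph_rec_circulant] by (simp add: free_edges_def)

lemma edge_shift_rec_circulant:
  assumes "x \<in> circ_verts n" "2 * i < n"
  shows "{x, (x + 4 ^ i) mod 2 ^ n} \<in> edges (rec_circulant n)"
proof (rule edge_rec_circulantI)
  have "[x - (x + 4 ^ i) mod 2 ^ n = x - (x + 4 ^ i)] (mod 2 ^ n)"
    by (intro cong_diff cong_refl) simp
  then show "rec_circulant_adj n x ((x + 4 ^ i) mod 2 ^ n)"
    using assms(2) by (auto simp: rec_circulant_adj_iff)
qed (use assms pos_mod_bound[of "2 ^ n" "x + 4 ^ i"] in auto)

text \<open>Multiplication by 4 turns the difference \<open>4 ^ i\<close> modulo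
  \<open>2 ^ n\<close> into \<open>4 ^ Suc i\<close> modulo \<open>2 ^ (n + 2)\<close>, so each
  residue class mod 4 carries a copy of the smaller graph.\<close>

lemma edge_lift_rec_circulant:
  assumes "e \<in> edges (rec_circulant n)" "r \<in> {0..<4}"
  shows "(\<lambda>k. 4 * k + r) ` e \<in> edges (rec_circulant (n + 2))"
proof -
  obtain u v where e: "e = {u, v}" "u \<in> circ_verts n" "v \<in> circ_verts n" "rec_circulant_adj n u v"
    using assms(1) by (auto simp: rec_circulant_def)
  then obtain i where i: "2 * i < n" "[u - v = 4 ^ i] (mod 2 ^ n) \<or> [u - v = - (4 ^ i)] (mod 2 ^ n)"
    by (auto simp: rec_circulant_adj_iff)
  have scale: "[4 * a = 4 * b] (mod 2 ^ (n + 2))" if "[a = b] (mod 2 ^ n)" for a b :: int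
  proof -
    have "4 * 2 ^ n dvd 4 * (a - b)"
      using that by (intro mult_dvd_mono) (auto simp: cong_iff_dvd_diff)
    then show ?thesis
      by (simp add: cong_iff_dvd_diff right_diff_distrib)
  qed
  have diff: "4 * u + r - (4 * v + r) = 4 * (u - v)"
    by simp
  have "[4 * u + r - (4 * v + r) = 4 ^ Suc i] (mod 2 ^ (n + 2)) \<or>
      [4 * u + r - (4 * v + r) = - (4 ^ Suc i)] (mod 2 ^ (n + 2))"
    unfolding diff using i(2) scale[of "u - v" "4 ^ i"] scale[of "u - v" "- (4 ^ i)"] by auto
  moreover have "2 * Suc i < n + 2" using i(1) by simp
  ultimately have "rec_circulant_adj (n + 2) (4 * u + r) (4 * v + r)"
    unfolding rec_circulant_adj_iff by blast
  then show ?thesis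
    unfolding e(1) using e(2,3) assms(2) by (auto intro!: edge_rec_circulantI simp: algebra_simps)
qed

text \<open>The surplus \<open>k\<close> is what a fault set has to overcome:
  \<open>expanding_card_faults\<close> derives that every fatal fault set has more than
  \<open>k\<close> elements.\<close>

definition expanding :: "nat \<Rightarrow> nat \<Rightarrow> bool" where
  "expanding n k \<longleftrightarrow>
     (\<forall>S U. S \<subseteq> circ_verts n \<and> U \<subseteq> circ_verts n \<and> S \<inter> U = {} \<and> S \<noteq> {} \<longrightarrow>
        card S + k \<le> card U + card (free_edges (rec_circulant n) S U))"

section \<open>Splitting into the four residue classes mod 4\<close>

definition res_class :: "int set \<Rightarrow> int \<Rightarrow> int set" where
  "res_class X r = {x \<in> X. x mod 4 = r}"

text \<open>The class \<open>r\<close> moved to the smaller graph, along the inverse of the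
  embedding in \<open>edge_lift_rec_circulant\<close>.\<close>

definition contract :: "int set \<Rightarrow> int \<Rightarrow> int set" where
  "contract X r = {k. 4 * k + r \<in> X}"

lemma card_res_class_sum:
  assumes "finite X"
  shows "card X = card (res_class X 0) + card (res_class X 1) + card (res_class X 2) + card (res_class X 3)"
proof -
  have "X = (\<Union>r\<in>{0,1,2,3}. res_class X r)"
    unfolding res_class_def by auto
  also have "card \<dots> = (\<Sum>r\<in>{0,1,2,3}. card (res_class X r))"
    using assms by (intro card_UN_disjoint) (auto simp: res_class_def)
  finally show ?thesis by simp
qed

lemma card_contract:
  assumes "r \<in> {0..<4}"
  shows "card (contract X r) = card (res_class X r)"
proof -
  have "res_class X r = (\<lambda>k. 4 * k + r) ` contract X r"
  proof -
    have "x = 4 * (x div 4) + r" if "x mod 4 = r" for x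
      using that by presburger
    moreover have "(4 * k + r) mod 4 = r" for k
      using assms by auto
    ultimately show ?thesis
      by (auto simp: res_class_def contract_def image_iff) metis+
  qed
  moreover have "inj_on (\<lambda>k. 4 * k + r) (contract X r)"
    by (auto simp: inj_on_def)
  ultimately show ?thesis by (simp add: card_image)
qed

lemma contract_subset:
  assumes "X \<subseteq> circ_verts (n + 2)" "r \<in> {0..<4}"
  shows "contract X r \<subseteq> circ_verts n"
proof
  fix k assume "k \<in> contract X r"
  then have "0 \<le> 4 * k + r" "4 * k + r \<le> 2 ^ (n + 2) - 1"
    using assms by (auto simp: contract_def)
  then show "k \<in> circ_verts n" using assms(2) by auto
qed

lemma bij_betw_succ: "bij_betw (\<lambda>x. (x + 1) mod 2 ^ n) (circ_verts n) (circ_verts n)"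
proof -
  have "inj_on (\<lambda>x. (x + 1) mod 2 ^ n) (circ_verts n)"
  proof (rule inj_onI)
    fix x y :: int assume "x \<in> circ_verts n" "y \<in> circ_verts n" "(x + 1) mod 2 ^ n = (y + 1) mod 2 ^ n"
    then show "x = y"
      by (metis add_diff_cancel_right' atLeastAtMost_iff mod_diff_left_eq mod_pos_pos_trivial zle_diff1_eq)
  qed
  moreover have "(\<lambda>x. (x + 1) mod 2 ^ n) ` circ_verts n \<subseteq> circ_verts n"
    using pos_mod_bound[of "2 ^ n :: int"] by auto
  ultimately show ?thesis
    by (simp add: bij_betw_def endo_inj_surj)
qed

text \<open>\<open>C\<close> records the free edges of the Hamiltonian cycle by their tails. The
  cycle joins a vertex of \<open>S\<close> to one vertex of each adjacent class, and that vertex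
  lies in \<open>U\<close> unless the edge is free. The two bounds follow the cycle forwards and
  backwards.\<close>

lemma card_le_res_class:
  assumes SU: "S \<subseteq> circ_verts n" "U \<subseteq> circ_verts n" "S \<inter> U = {}"
    and n: "n \<ge> 2" and r: "r \<in> {0..<4}"
  defines "nxt \<equiv> \<lambda>x. (x + 1) mod 2 ^ n"
  defines "C \<equiv> {x \<in> circ_verts n. {x, nxt x} \<inter> S \<noteq> {} \<and> {x, nxt x} \<inter> U = {}}"
  shows "card (res_class S r) \<le> card (res_class U ((r + 1) mod 4)) + card (res_class C r)"
    and "card (res_class S ((r + 1) mod 4)) \<le> card (res_class U r) + card (res_class C r)"
proof -
  \<comment> \<open>Reduction modulo \<open>2 ^ n\<close> thus keeps residues mod 4, also where the
    cycle wraps around.\<close>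
  have "(4 :: int) dvd 2 ^ n"
    using n le_imp_power_dvd[of 2 n "2 :: int"] by simp
  then have mod4: "nxt x mod 4 = (x + 1) mod 4" for x
    by (simp add: nxt_def mod_mod_cancel)
  have inj: "inj_on nxt (circ_verts n)" and surj: "nxt ` circ_verts n = circ_verts n"
    using bij_betw_succ[of n] by (auto simp: bij_betw_def nxt_def)
  have fin: "finite (res_class X r)" if "X \<subseteq> circ_verts n" for X r
    using that by (auto simp: res_class_def intro: finite_subset)
  have CV: "C \<subseteq> circ_verts n" by (auto simp: C_def)
  define D where "D = {x \<in> circ_verts n. x mod 4 = r \<and> nxt x \<in> U}"
  have "finite D"
    by (rule finite_subset[of _ "circ_verts n"]) (auto simp: D_def)
  have "res_class S r \<subseteq> D \<union> res_class C r"
    using SU by (auto simp: res_class_def D_def C_def)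
  then have "card (res_class S r) \<le> card (D \<union> res_class C r)"
    using fin[OF CV] \<open>finite D\<close> by (intro card_mono) simp_all
  also have "\<dots> \<le> card D + card (res_class C r)" by (rule card_Un_le)
  also have "card D = card (nxt ` D)"
    using inj by (intro card_image[symmetric]) (auto simp: D_def inj_on_def)
  also have "\<dots> \<le> card (res_class U ((r + 1) mod 4))"
    using fin[OF SU(2)] by (intro card_mono) (auto simp: D_def res_class_def mod4 mod_add_left_eq)
  finally show "card (res_class S r) \<le> card (res_class U ((r + 1) mod 4)) + card (res_class C r)"
    by simp
  have "res_class S ((r + 1) mod 4) \<subseteq> nxt ` (res_class U r \<union> res_class C r)"
  proof
    fix y assume y: "y \<in> res_class S ((r + 1) mod 4)"
    then have "y \<in> nxt ` circ_verts n"
      using SU(1) unfolding surj res_class_def by blast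
    then obtain x where x: "x \<in> circ_verts n" "y = nxt x"
      by (rule imageE) blast
    then have "(x + 1) mod 4 = (r + 1) mod 4"
      using y by (simp add: res_class_def mod4)
    then have "x mod 4 = r mod 4"
      by (simp add: mod_eq_dvd_iff)
    then have "x mod 4 = r" using r by simp
    then show "y \<in> nxt ` (res_class U r \<union> res_class C r)"
      using x y SU(3) by (auto simp: res_class_def C_def)
  qed
  then have "card (res_class S ((r + 1) mod 4)) \<le> card (res_class U r \<union> res_class C r)"
    using fin[OF SU(2)] fin[OF CV] by (meson finite_UnI surj_card_le)
  also have "\<dots> \<le> card (res_class U r) + card (res_class C r)" by (rule card_Un_le)
  finally show "card (res_class S ((r + 1) mod 4)) \<le> card (res_class U r) + card (res_class C r)" .
qed

text \<open>Lifted edges have both ends in one residue class and cycle edges have ends in different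
  ones, so the five families are disjoint and their sizes add up.\<close>

lemma card_free_edges_split:
  assumes SU: "S \<subseteq> circ_verts (n + 2)" "U \<subseteq> circ_verts (n + 2)"
  defines "nxt \<equiv> \<lambda>x. (x + 1) mod 2 ^ (n + 2)"
  defines "C \<equiv> {x \<in> circ_verts (n + 2). {x, nxt x} \<inter> S \<noteq> {} \<and> {x, nxt x} \<inter> U = {}}"
  shows "(\<Sum>r\<in>{0,1,2,3}. card (free_edges (rec_circulant n) (contract S r) (contract U r))) + card C
    \<le> card (free_edges (rec_circulant (n + 2)) S U)"
proof -
  let ?N = "2 ^ (n + 2) :: int"
  let ?R = "{0,1,2,3} :: int set"
  define B where "B r = (`) (\<lambda>k. 4 * k + r) ` free_edges (rec_circulant n) (contract S r) (contract U r)" for r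
  define D where "D = (\<lambda>x. {x, nxt x}) ` C"
  have mod4: "nxt x mod 4 = (x + 1) mod 4" for x
    by (simp add: nxt_def mod_mod_cancel)
  note fin = finite_free_edges_rec_circulant
  have B_mod: "x mod 4 = r" if "r \<in> ?R" "e \<in> B r" "x \<in> e" for e r x
    using that by (auto simp: B_def)
  have B_ne: "e \<noteq> {}" if "e \<in> B r" for e r
    using that by (auto simp: B_def free_edges_def)
  have D_mod: "\<exists>x\<in>e. \<exists>y\<in>e. x mod 4 \<noteq> y mod 4" if e_D: "e \<in> D" for e
  proof -
    obtain x where "e = {x, nxt x}" using e_D by (auto simp: D_def)
    moreover have "x mod 4 \<noteq> nxt x mod 4" unfolding mod4 by presburger
    ultimately show ?thesis by blast
  qed
  have "inj_on (\<lambda>x. {x, nxt x}) (circ_verts (n + 2))"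
  proof (rule inj_onI)
    fix x y assume xy: "x \<in> circ_verts (n + 2)" "y \<in> circ_verts (n + 2)" "{x, nxt x} = {y, nxt y}"
    show "x = y"
    proof (rule ccontr)
      assume "x \<noteq> y"
      then have "x = nxt y" "y = nxt x" using xy(3) by (auto simp: doubleton_eq_iff)
      \<comment> \<open>Two different tails of one edge would be successors of each other, which
        forces 2 to vanish mod 4.\<close>
      then have "x mod 4 = (y + 1) mod 4" "y mod 4 = (x + 1) mod 4"
        using mod4 by metis+
      then have "4 dvd (x - (y + 1)) + (y - (x + 1))"
        by (intro dvd_add) (simp_all only: mod_eq_dvd_iff)
      then show False by simp
    qed
  qed
  then have cardD: "card D = card C"
    unfolding D_def by (intro card_image) (auto simp: C_def inj_on_def)
  have cardB: "card (B r) = card (free_edges (rec_circulant n) (contract S r) (contract U r))" for r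
    unfolding B_def
    by (intro card_image inj_on_subset[OF inj_on_image, of _ UNIV]) (auto simp: inj_on_def)
  have "(\<Sum>r\<in>?R. card (B r)) + card D = card (\<Union>r\<in>?R. B r) + card D"
  proof -
    have "B r \<inter> B r' = {}" if "r \<in> ?R" "r' \<in> ?R" "r \<noteq> r'" for r r'
    proof (rule equals0I)
      fix e assume "e \<in> B r \<inter> B r'"
      moreover from this obtain x where "x \<in> e" using B_ne by blast
      ultimately show False using B_mod that by (metis IntE)
    qed
    then have "card (\<Union>r\<in>?R. B r) = (\<Sum>r\<in>?R. card (B r))"
      using fin by (intro card_UN_disjoint) (auto simp: B_def)
    then show ?thesis by simp
  qed
  also have "\<dots> = card ((\<Union>r\<in>?R. B r) \<union> D)"
  proof (rule card_Un_disjoint[symmetric])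
    show "(\<Union>r\<in>?R. B r) \<inter> D = {}"
    proof (rule equals0I)
      fix e assume e: "e \<in> (\<Union>r\<in>?R. B r) \<inter> D"
      then obtain r where r: "r \<in> ?R" "e \<in> B r" by blast
      obtain x y where "x \<in> e" "y \<in> e" "x mod 4 \<noteq> y mod 4"
        using D_mod e by blast
      then show False using B_mod[OF r] by simp
    qed
    have "finite C" by (rule finite_subset[of _ "circ_verts (n + 2)"]) (auto simp: C_def)
    then show "finite D" by (simp add: D_def)
  qed (use fin in \<open>auto simp: B_def\<close>)
  also have "\<dots> \<le> card (free_edges (rec_circulant (n + 2)) S U)"
  proof (intro card_mono fin Un_least UN_least)
    fix r assume "r \<in> ?R"
    then have "r \<in> {0..<4}" by auto
    then show "B r \<subseteq> free_edges (rec_circulant (n + 2)) S U"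
      using edge_lift_rec_circulant[of _ n r] by (auto simp: B_def free_edges_def contract_def)
  next
    show "D \<subseteq> free_edges (rec_circulant (n + 2)) S U"
      using edge_shift_rec_circulant[of _ "n + 2" 0] by (auto simp: D_def C_def free_edges_def nxt_def)
  qed
  finally show ?thesis by (simp add: cardB cardD)
qed

text \<open>Reduces the inductive step to linear arithmetic: per class \<open>r\<close>,
  \<open>s\<close> and \<open>u\<close> count the vertices of \<open>S\<close> and \<open>U\<close>,
  \<open>b\<close> the free edges inside the class and \<open>c\<close> the free cycle edges to the
  next class. The sets \<open>S'\<close> and \<open>U'\<close> give access to what is known about
  the smaller graph.\<close>

lemma split_four:
  assumes "S \<subseteq> circ_verts (n + 2)" "U \<subseteq> circ_verts (n + 2)" "S \<inter> U = {}"
  obtains s u b c :: "int \<Rightarrow> nat" where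
    "card S = s 0 + s 1 + s 2 + s 3" "card U = u 0 + u 1 + u 2 + u 3"
    "b 0 + b 1 + b 2 + b 3 + c 0 + c 1 + c 2 + c 3 \<le> card (free_edges (rec_circulant (n + 2)) S U)"
    "\<And>r. r \<in> {0..<4} \<Longrightarrow> \<exists>S' U'. S' \<subseteq> circ_verts n \<and> U' \<subseteq> circ_verts n \<and> S' \<inter> U' = {} \<and>
       card S' = s r \<and> card U' = u r \<and> card (free_edges (rec_circulant n) S' U') = b r"
    "\<And>r. r \<in> {0..<4} \<Longrightarrow> s r \<le> u ((r + 1) mod 4) + c r"
    "\<And>r. r \<in> {0..<4} \<Longrightarrow> s ((r + 1) mod 4) \<le> u r + c r"
proof -
  define C where "C = {x \<in> circ_verts (n + 2). {x, (x + 1) mod 2 ^ (n + 2)} \<inter> S \<noteq> {} \<and>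
    {x, (x + 1) mod 2 ^ (n + 2)} \<inter> U = {}}"
  have "C \<subseteq> circ_verts (n + 2)" by (auto simp: C_def)
  then have fin: "finite S" "finite U" "finite C"
    using assms finite_subset[OF _ finite_atLeastAtMost_int] by blast+
  show thesis
  proof (rule that[of "\<lambda>r. card (res_class S r)" "\<lambda>r. card (res_class U r)"
        "\<lambda>r. card (free_edges (rec_circulant n) (contract S r) (contract U r))"
        "\<lambda>r. card (res_class C r)"])
    fix r :: int assume r: "r \<in> {0..<4}"
    show "\<exists>S' U'. S' \<subseteq> circ_verts n \<and> U' \<subseteq> circ_verts n \<and> S' \<inter> U' = {} \<and>
       card S' = card (res_class S r) \<and> card U' = card (res_class U r) \<and>
       card (free_edges (rec_circulant n) S' U') = card (free_edges (rec_circulant n) (contract S r) (contract U r))"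
      using contract_subset[OF assms(1) r] contract_subset[OF assms(2) r] card_contract[OF r] assms(3)
      by (intro exI[of _ "contract S r"] exI[of _ "contract U r"]) (auto simp: contract_def)
    show "card (res_class S r) \<le> card (res_class U ((r + 1) mod 4)) + card (res_class C r)"
      "card (res_class S ((r + 1) mod 4)) \<le> card (res_class U r) + card (res_class C r)"
      using card_le_res_class[OF assms(1-3) _ r] by (simp_all add: C_def)
  next
    show "card (free_edges (rec_circulant n) (contract S 0) (contract U 0)) +
      card (free_edges (rec_circulant n) (contract S 1) (contract U 1)) +
      card (free_edges (rec_circulant n) (contract S 2) (contract U 2)) +
      card (free_edges (rec_circulant n) (contract S 3) (contract U 3)) +
      card (res_class C 0) + card (res_class C 1) + card (res_class C 2) + card (res_class C 3)
      \<le> card (free_edges (rec_circulant (n + 2)) S U)"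
      using card_free_edges_split[OF assms(1,2)] card_res_class_sum[OF fin(3)]
      by (simp add: C_def)
  qed (use card_res_class_sum fin in auto)
qed

section \<open>Inequalities for the four classes and the inductive step\<close>

lemma four_classes_degree:
  fixes s u b c :: "int \<Rightarrow> nat"
  assumes "s 0 + s 1 + s 2 + s 3 = 1"
    and deg: "\<And>r. r \<in> {0..<4} \<Longrightarrow> s r = 1 \<Longrightarrow> n \<le> u r + b r"
    and c1: "\<And>r. r \<in> {0..<4} \<Longrightarrow> s r \<le> u ((r + 1) mod 4) + c r"
    and c2: "\<And>r. r \<in> {0..<4} \<Longrightarrow> s ((r + 1) mod 4) \<le> u r + c r"
  shows "n + 2 \<le> u 0 + u 1 + u 2 + u 3 + (b 0 + b 1 + b 2 + b 3 + c 0 + c 1 + c 2 + c 3)"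
proof -
  \<comment> \<open>The class of the single vertex contributes \<open>n\<close>, and each of the two
    adjacent classes one more through the matchings.\<close>
  consider "s 0 = 1" | "s 1 = 1" | "s 2 = 1" | "s 3 = 1"
    using assms(1) by linarith
  then show ?thesis
    using deg[of 0] deg[of 1] deg[of 2] deg[of 3]
      c1[of 0] c1[of 1] c1[of 2] c1[of 3] c2[of 0] c2[of 1] c2[of 2] c2[of 3]
    by cases simp_all
qed

text \<open>If \<open>m \<ge> 2\<close> classes meet \<open>S\<close>, they have surplus at least
  \<open>m * k\<close>. Each of the \<open>4 - m\<close> other classes is adjacent to one of them
  and pays at least 1, and \<open>m * k + 4 - m \<ge> k + 3\<close> because
  \<open>k \<ge> 1\<close>. If only one class meets \<open>S\<close>, both adjacent classes pay its
  full \<open>s r\<close>.\<close>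

lemma four_classes_expanding:
  fixes s u b c :: "int \<Rightarrow> nat"
  assumes "k \<ge> 1" "s 0 + s 1 + s 2 + s 3 > 0"
    and exp: "\<And>r. r \<in> {0..<4} \<Longrightarrow> s r > 0 \<Longrightarrow> s r + k \<le> u r + b r"
    and deg: "\<And>r. r \<in> {0..<4} \<Longrightarrow> s r = 1 \<Longrightarrow> n \<le> u r + b r"
    and c1: "\<And>r. r \<in> {0..<4} \<Longrightarrow> s r \<le> u ((r + 1) mod 4) + c r"
    and c2: "\<And>r. r \<in> {0..<4} \<Longrightarrow> s ((r + 1) mod 4) \<le> u r + c r"
  shows "s 0 + s 1 + s 2 + s 3 + min (k + 3) (n + 1) \<le>
    u 0 + u 1 + u 2 + u 3 + (b 0 + b 1 + b 2 + b 3 + c 0 + c 1 + c 2 + c 3)"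
proof -
  define K where "K = min (k + 3) (n + 1)"
  \<comment> \<open>The last conjunct is for a class that alone meets \<open>S\<close>, with
    \<open>2 * s r\<close> paid by its neighbours. It follows from \<open>deg\<close> if
    \<open>s r = 1\<close> and from \<open>exp\<close> otherwise, as then
    \<open>2 * s r \<ge> 3\<close>.\<close>
  define P where "P r \<longleftrightarrow> s r > 0 \<and> s r + k \<le> u r + b r \<and> s r + K \<le> u r + b r + 2 * s r" for r
  have P: "s r = 0 \<or> P r" if r: "r \<in> {0..<4}" for r
  proof -
    consider "s r = 0" | "s r = 1" | "s r \<ge> 2" by linarith
    then show ?thesis
      using exp[OF r] deg[OF r] by cases (auto simp: K_def P_def)
  qed
  have c: "s 0 \<le> u 1 + c 0" "s 1 \<le> u 2 + c 1" "s 2 \<le> u 3 + c 2" "s 3 \<le> u 0 + c 3"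
    "s 1 \<le> u 0 + c 0" "s 2 \<le> u 1 + c 1" "s 3 \<le> u 2 + c 2" "s 0 \<le> u 3 + c 3"
    using c1[of 0] c1[of 1] c1[of 2] c1[of 3] c2[of 0] c2[of 1] c2[of 2] c2[of 3] by simp_all
  have "s 0 = 0 \<and> s 1 \<le> u 0 + c 0 \<and> s 3 \<le> u 0 + c 3 \<or> P 0"
    "s 1 = 0 \<and> s 0 \<le> u 1 + c 0 \<and> s 2 \<le> u 1 + c 1 \<or> P 1"
    "s 2 = 0 \<and> s 1 \<le> u 2 + c 1 \<and> s 3 \<le> u 2 + c 2 \<or> P 2"
    "s 3 = 0 \<and> s 2 \<le> u 3 + c 2 \<and> s 0 \<le> u 3 + c 3 \<or> P 3"
    using P[of 0] P[of 1] P[of 2] P[of 3] c by simp_all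
  moreover have "K \<le> k + 3" by (simp add: K_def)
  ultimately show ?thesis
    using assms(1,2) unfolding P_def K_def[symmetric] by (elim disjE conjE; linarith)
qed

lemma degree_step:
  assumes IH: "\<And>S U. S \<subseteq> circ_verts n \<Longrightarrow> U \<subseteq> circ_verts n \<Longrightarrow> S \<inter> U = {} \<Longrightarrow> card S = 1 \<Longrightarrow>
      n \<le> card U + card (free_edges (rec_circulant n) S U)"
    and SU: "S \<subseteq> circ_verts (n + 2)" "U \<subseteq> circ_verts (n + 2)" "S \<inter> U = {}" "card S = 1"
  shows "n + 2 \<le> card U + card (free_edges (rec_circulant (n + 2)) S U)"
proof -
  obtain s u b c :: "int \<Rightarrow> nat" where
    s: "card S = s 0 + s 1 + s 2 + s 3" and u: "card U = u 0 + u 1 + u 2 + u 3"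
    and b: "b 0 + b 1 + b 2 + b 3 + c 0 + c 1 + c 2 + c 3 \<le> card (free_edges (rec_circulant (n + 2)) S U)"
    and ex: "\<And>r. r \<in> {0..<4} \<Longrightarrow> \<exists>S' U'. S' \<subseteq> circ_verts n \<and> U' \<subseteq> circ_verts n \<and> S' \<inter> U' = {} \<and>
       card S' = s r \<and> card U' = u r \<and> card (free_edges (rec_circulant n) S' U') = b r"
    and c1: "\<And>r. r \<in> {0..<4} \<Longrightarrow> s r \<le> u ((r + 1) mod 4) + c r"
    and c2: "\<And>r. r \<in> {0..<4} \<Longrightarrow> s ((r + 1) mod 4) \<le> u r + c r"
    by (rule split_four[OF SU(1-3)]) blast
  have deg: "n \<le> u r + b r" if "r \<in> {0..<4}" "s r = 1" for r
    using ex[OF that(1)] that(2) IH by metis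
  have "n + 2 \<le> u 0 + u 1 + u 2 + u 3 + (b 0 + b 1 + b 2 + b 3 + c 0 + c 1 + c 2 + c 3)"
    using s SU(4) deg c1 c2 by (intro four_classes_degree[of s]) simp_all
  then show ?thesis using u b by linarith
qed

text \<open>Each edge at the vertex of \<open>S\<close> is free or ends in \<open>U\<close>. This
  degree bound handles the classes with a single vertex of \<open>S\<close> in
  \<open>expanding_step\<close>; the induction goes in steps of two and starts at 0 and 1.\<close>

lemma degree_rec_circulant:
  assumes "S \<subseteq> circ_verts n" "U \<subseteq> circ_verts n" "S \<inter> U = {}" "card S = 1"
  shows "n \<le> card U + card (free_edges (rec_circulant n) S U)"
  using assms
proof (induction n arbitrary: S U rule: nat_induct2)
  case 1
  have e: "{0, 1} \<in> edges (rec_circulant 1)"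
    using edge_shift_rec_circulant[of 0 1 0] by simp
  obtain x where x: "S = {x}"
    using 1(4) by (rule card_1_singletonE)
  then have "x \<in> {0, 1}" using 1(1) by auto
  show ?case
  proof (cases "U = {}")
    case True
    then have "{0, 1} \<in> free_edges (rec_circulant 1) S U"
      using e x \<open>x \<in> {0, 1}\<close> by (auto simp: free_edges_def)
    then show ?thesis
      using finite_free_edges_rec_circulant card_gt_0_iff by (metis One_nat_def Suc_leI empty_iff trans_le_add2)
  next
    case False
    then have "card U > 0"
      using 1(2) finite_subset card_gt_0_iff by blast
    then show ?thesis by simp
  qed
next
  case (step n)
  then show ?case by (intro degree_step) auto
qed simp

text \<open>The cap \<open>n + 1\<close> cannot be exceeded: for a single vertex \<open>S\<close>
  and \<open>U = {}\<close> there are only \<open>n + 2\<close> free edges.\<close>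

lemma expanding_step:
  assumes "expanding n k" "k \<ge> 1"
  shows "expanding (n + 2) (min (k + 3) (n + 1))"
  unfolding expanding_def
proof (intro allI impI, elim conjE)
  fix S U assume SU: "S \<subseteq> circ_verts (n + 2)" "U \<subseteq> circ_verts (n + 2)" "S \<inter> U = {}" "S \<noteq> {}"
  obtain s u b c :: "int \<Rightarrow> nat" where
    s: "card S = s 0 + s 1 + s 2 + s 3" and u: "card U = u 0 + u 1 + u 2 + u 3"
    and b: "b 0 + b 1 + b 2 + b 3 + c 0 + c 1 + c 2 + c 3 \<le> card (free_edges (rec_circulant (n + 2)) S U)"
    and ex: "\<And>r. r \<in> {0..<4} \<Longrightarrow> \<exists>S' U'. S' \<subseteq> circ_verts n \<and> U' \<subseteq> circ_verts n \<and> S' \<inter> U' = {} \<and>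
       card S' = s r \<and> card U' = u r \<and> card (free_edges (rec_circulant n) S' U') = b r"
    and c1: "\<And>r. r \<in> {0..<4} \<Longrightarrow> s r \<le> u ((r + 1) mod 4) + c r"
    and c2: "\<And>r. r \<in> {0..<4} \<Longrightarrow> s ((r + 1) mod 4) \<le> u r + c r"
    by (rule split_four[OF SU(1-3)]) blast
  have deg: "n \<le> u r + b r" if "r \<in> {0..<4}" "s r = 1" for r
    using ex[OF that(1)] that(2) degree_rec_circulant by metis
  have exp: "s r + k \<le> u r + b r" if "r \<in> {0..<4}" "s r > 0" for r
    using ex[OF that(1)] that(2) assms(1) unfolding expanding_def by (metis card.empty less_irrefl)
  have "card S > 0"
    using SU by (meson card_gt_0_iff finite_atLeastAtMost_int finite_subset)
  then have "s 0 + s 1 + s 2 + s 3 + min (k + 3) (n + 1) \<le>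
      u 0 + u 1 + u 2 + u 3 + (b 0 + b 1 + b 2 + b 3 + c 0 + c 1 + c 2 + c 3)"
    using s deg exp c1 c2 assms(2) by (intro four_classes_expanding) simp_all
  then show "card S + min (k + 3) (n + 1) \<le> card U + card (free_edges (rec_circulant (n + 2)) S U)"
    using s u b by linarith
qed

section \<open>The graphs with 8 and 16 vertices\<close>

text \<open>With this encoding \<open>card U - card S\<close> is a sum over the vertices, and
  whether an edge is free depends on the two values at its ends only.\<close>

definition mark :: "int set \<Rightarrow> int set \<Rightarrow> int \<Rightarrow> int" where
  "mark S U x = (if x \<in> U then 1 else if x \<in> S then - 1 else 0)"

definition is_free :: "int \<Rightarrow> int \<Rightarrow> int" where
  "is_free a b = (if (a = - 1 \<or> b = - 1) \<and> a \<noteq> 1 \<and> b \<noteq> 1 then 1 else 0)"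

lemma mark_values: "mark S U x \<in> {- 1, 0, 1}"
  by (simp add: mark_def)

lemma is_free_mark:
  assumes "S \<inter> U = {}"
  shows "is_free (mark S U x) (mark S U y) = of_bool ({x, y} \<inter> S \<noteq> {} \<and> {x, y} \<inter> U = {})"
  using assms by (auto simp: mark_def is_free_def)

lemma sum_mark:
  assumes "finite V" "S \<subseteq> V" "U \<subseteq> V" "S \<inter> U = {}"
  shows "(\<Sum>x\<in>V. mark S U x) = int (card U) - int (card S)"
proof -
  have "mark S U x = of_bool (x \<in> U) - of_bool (x \<in> S)" for x
    using assms(4) by (auto simp: mark_def)
  then have "(\<Sum>x\<in>V. mark S U x) = (\<Sum>x\<in>V. of_bool (x \<in> U)) - (\<Sum>x\<in>V. of_bool (x \<in> S))"
    by (simp add: sum_subtractf)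
  also have "\<dots> = int (card (V \<inter> U)) - int (card (V \<inter> S))"
    using assms(1) by (simp add: of_bool_def sum.If_cases Int_def)
  finally show ?thesis using assms by (simp add: Int_absorb1)
qed

text \<open>Numbering the vertices along the cycle from \<open>x\<close> lets any chosen vertex have
  index 0.\<close>

lemma bij_betw_rotation:
  "bij_betw (\<lambda>i. (x + int i) mod 2 ^ n) {..<2 ^ n} (circ_verts n)"
proof -
  have inj: "inj_on (\<lambda>i. (x + int i) mod 2 ^ n) {..<2 ^ n}"
  proof (rule inj_onI)
    fix i j :: nat assume ij: "i \<in> {..<2 ^ n}" "j \<in> {..<2 ^ n}"
      "(x + int i) mod 2 ^ n = (x + int j) mod 2 ^ n"
    then have "2 ^ n dvd int i - int j"
      by (simp add: mod_eq_dvd_iff)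
    then have "int i mod 2 ^ n = int j mod 2 ^ n"
      by (simp only: mod_eq_dvd_iff)
    moreover have "int i < 2 ^ n" "int j < 2 ^ n"
      using ij(1,2) by simp_all
    ultimately show "i = j"
      using mod_pos_pos_trivial[of "int i" "2 ^ n"] mod_pos_pos_trivial[of "int j" "2 ^ n"] by linarith
  qed
  have "(\<lambda>i. (x + int i) mod 2 ^ n) ` {..<2 ^ n} = circ_verts n"
  proof (rule card_subset_eq)
    show "(\<lambda>i. (x + int i) mod 2 ^ n) ` {..<2 ^ n} \<subseteq> circ_verts n"
      using pos_mod_bound[of "2 ^ n :: int"] by auto
    show "card ((\<lambda>i. (x + int i) mod 2 ^ n) ` {..<2 ^ n}) = card (circ_verts n)"
      unfolding card_image[OF inj] by (simp add: nat_power_eq)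
  qed simp
  then show ?thesis using inj by (simp add: bij_betw_def)
qed

lemma is_free_sum_le:
  fixes e :: "'i \<Rightarrow> int \<times> int"
  assumes "S \<inter> U = {}" "finite I" and inj: "inj_on (\<lambda>i. {fst (e i), snd (e i)}) I"
    and edge: "\<And>i. i \<in> I \<Longrightarrow> {fst (e i), snd (e i)} \<in> edges (rec_circulant n)"
  shows "(\<Sum>i\<in>I. is_free (mark S U (fst (e i))) (mark S U (snd (e i))))
    \<le> int (card (free_edges (rec_circulant n) S U))"
proof -
  let ?e = "\<lambda>i. {fst (e i), snd (e i)}"
  let ?J = "{i \<in> I. ?e i \<inter> S \<noteq> {} \<and> ?e i \<inter> U = {}}"
  have "(\<Sum>i\<in>I. is_free (mark S U (fst (e i))) (mark S U (snd (e i)))) = int (card ?J)"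
    unfolding is_free_mark[OF assms(1)] using assms(2) by (simp add: of_bool_def sum.If_cases Int_def)
  also have "card ?J = card (?e ` ?J)"
    using inj by (intro card_image[symmetric]) (auto simp: inj_on_def)
  also have "\<dots> \<le> card (free_edges (rec_circulant n) S U)"
    using edge by (intro card_mono finite_free_edges_rec_circulant) (auto simp: free_edges_def)
  finally show ?thesis by simp
qed

text \<open>For \<open>n = 3\<close> the indices \<open>i\<close> and \<open>i + 4\<close> give the same edge \<open>{x + i, x + i + 4}\<close>, so only half of
  them are summed over.\<close>

lemma base_sums:
  fixes S U :: "int set" and x :: int
  assumes SU: "S \<subseteq> circ_verts n" "U \<subseteq> circ_verts n" "S \<inter> U = {}"
    and n: "n = 3 \<and> M = 4 \<or> n = 4 \<and> M = 16"
  defines "Z \<equiv> \<lambda>i. mark S U ((x + int i) mod 2 ^ n)"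
  shows "(\<Sum>i<2 ^ n. is_free (Z i) (Z (i + 1))) + (\<Sum>i<M. is_free (Z i) (Z (i + 4)))
      \<le> int (card (free_edges (rec_circulant n) S U))"
    and "(\<Sum>i<2 ^ n. Z i) = int (card U) - int (card S)"
    and "Z (i + 2 ^ n) = Z i"
proof -
  let ?p = "\<lambda>i. (x + int i) mod 2 ^ n"
  let ?I = "{..<2 ^ n} \<times> {1} \<union> {..<M} \<times> {4 :: nat}"
  let ?e = "\<lambda>(i, g). (?p i, ?p (i + g))"
  show "(\<Sum>i<2 ^ n. Z i) = int (card U) - int (card S)"
    using sum.reindex_bij_betw[OF bij_betw_rotation[of x n], of "mark S U"] sum_mark[OF _ SU]
    by (simp add: Z_def)
  show "Z (i + 2 ^ n) = Z i"
    by (simp add: Z_def flip: add.assoc)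
  have "inj_on (\<lambda>i. {fst (?e i), snd (?e i)}) ?I"
  proof (rule inj_onI)
    fix a b assume ab: "a \<in> ?I" "b \<in> ?I" "{fst (?e a), snd (?e a)} = {fst (?e b), snd (?e b)}"
    obtain i g j h where a: "a = (i, g)" and b: "b = (j, h)" by fastforce
    have gh: "g \<in> {1, 4}" "h \<in> {1, 4}" and ij: "i < 2 ^ n" "j < 2 ^ n"
      and short: "g = 4 \<Longrightarrow> n = 3 \<Longrightarrow> i < 4" "h = 4 \<Longrightarrow> n = 3 \<Longrightarrow> j < 4"
      using ab(1,2) n by (auto simp: a b)
    have p_eq: "(2 :: int) ^ n dvd int i - int j" if "?p i = ?p j" for i j
      using that by (simp add: mod_eq_dvd_iff)
    consider "?p i = ?p j" "?p (i + g) = ?p (j + h)" | "?p i = ?p (j + h)" "?p (i + g) = ?p j"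
      using ab(3) by (auto simp: a b doubleton_eq_iff)
    then show "a = b"
    proof cases
      case 1
      then have "i = j"
        using bij_betw_rotation[of x n] ij by (auto simp: bij_betw_def inj_on_def)
      moreover have "(2 :: int) ^ n dvd int g - int h"
        using p_eq[OF 1(2)] \<open>i = j\<close> by simp
      then have "g = h"
        using gh n by auto
      ultimately show ?thesis by (simp add: a b)
    next
      case 2
      have dvd: "(2 :: int) ^ n dvd int i - int j - int h" "(2 :: int) ^ n dvd int i - int j + int g"
        using p_eq[OF 2(1)] p_eq[OF 2(2)] by (simp_all add: algebra_simps)
      \<comment> \<open>With the ends swapped, \<open>g + h\<close> is 2, 5 or 8, and only 8 can be
        a multiple of \<open>2 ^ n\<close>, for \<open>n = 3\<close>. This is the repetition that
        the restriction to \<open>i < 4\<close> rules out.\<close>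
      have "(2 :: int) ^ n dvd int g + int h"
        using dvd_diff[OF dvd(2,1)] by simp
      then have "g = 4" "h = 4" "n = 3"
        using gh n by auto
      then have "8 dvd int j + 4 - int i" "0 < int j + 4 - int i" "int j + 4 - int i < 8"
        using dvd(1) short by (simp_all add: dvd_diff_commute algebra_simps)
      then show ?thesis
        using zdvd_imp_le by fastforce
    qed
  qed
  moreover have "{fst (?e j), snd (?e j)} \<in> edges (rec_circulant n)" if j: "j \<in> ?I" for j
  proof -
    have p: "?p i \<in> circ_verts n" for i
      using pos_mod_bound[of "2 ^ n :: int" "x + int i"] by simp
    have "{?p i, ?p (i + 4 ^ m)} \<in> edges (rec_circulant n)" if "m \<in> {0, 1}" for i m
    proof -
      have "2 * m < n" using n that by auto
      then show ?thesis
        using edge_shift_rec_circulant[OF p, of m] by (simp add: mod_add_left_eq add.assoc)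
    qed
    from this[of 0] this[of 1] show ?thesis using j by (auto simp: add.commute)
  qed
  ultimately have "(\<Sum>i\<in>?I. is_free (mark S U (fst (?e i))) (mark S U (snd (?e i))))
      \<le> int (card (free_edges (rec_circulant n) S U))"
    by (intro is_free_sum_le SU(3)) auto
  also have "(\<Sum>i\<in>?I. is_free (mark S U (fst (?e i))) (mark S U (snd (?e i)))) =
      (\<Sum>i\<in>{..<2 ^ n} \<times> {1 :: nat}. is_free (mark S U (fst (?e i))) (mark S U (snd (?e i)))) +
      (\<Sum>i\<in>{..<M} \<times> {4 :: nat}. is_free (mark S U (fst (?e i))) (mark S U (snd (?e i))))"
    by (intro sum.union_disjoint) auto
  also have "\<dots> = (\<Sum>i<2 ^ n. is_free (Z i) (Z (i + 1))) + (\<Sum>i<M. is_free (Z i) (Z (i + 4)))"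
  proof -
    have "sum f (A \<times> {c}) = (\<Sum>i\<in>A. f (i, c))" for f :: "nat \<times> nat \<Rightarrow> int" and A c
      by (rule sum.reindex_bij_witness[of _ "\<lambda>i. (i, c)" fst]) auto
    then show ?thesis by (simp add: Z_def add_ac)
  qed
  finally show "(\<Sum>i<2 ^ n. is_free (Z i) (Z (i + 1))) + (\<Sum>i<M. is_free (Z i) (Z (i + 4)))
      \<le> int (card (free_edges (rec_circulant n) S U))" .
qed

text \<open>In a \<open>d\<close>-regular graph the sum of \<open>c * is_free a b + a + b\<close> over all edges, where \<open>a\<close> and \<open>b\<close>
  are the marks of the ends, is \<open>c\<close> times the number of free edges plus \<open>d * (|U| - |S|)\<close>. The bounds
  below make it a sum of nonnegative terms.\<close>

lemma is_free_weight4: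
  assumes "a \<in> {- 1, 0, 1}" "b \<in> {- 1, 0, 1}"
  shows "4 * is_free a b + a + b \<ge> \<bar>a + b\<bar>"
  using assms by (auto simp: is_free_def)

text \<open>The doubling is for \<open>a = b = - 1\<close>, where
  \<open>3 * is_free a b + a + b\<close> is 1 but the right-hand side is 2.\<close>

lemma is_free_weight3:
  assumes "a \<in> {- 1, 0, 1}" "b \<in> {- 1, 0, 1}"
  shows "6 * is_free a b + 2 * a + 2 * b \<ge> \<bar>a + b\<bar>"
  using assms by (auto simp: is_free_def)

text \<open>For marks, the right-hand side indicates that the edge crosses the boundary of
  \<open>S \<union> U\<close>.\<close>

lemma is_free_weight2:
  assumes "a \<in> {- 1, 0, 1}" "b \<in> {- 1, 0, 1}"
  shows "2 * is_free a b + a + b \<ge> \<bar>\<bar>a\<bar> - \<bar>b\<bar>\<bar>"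
  using assms by (auto simp: is_free_def)

section \<open>Weight inequalities on 8 and 16 vertices\<close>

lemma sum_lessThan_numerals:
  fixes f :: "nat \<Rightarrow> int"
  shows "(\<Sum>i<4. f i) = f 0 + f 1 + f 2 + f 3"
    and "(\<Sum>i<8. f i) = f 0 + f 1 + f 2 + f 3 + f 4 + f 5 + f 6 + f 7"
    and "(\<Sum>i<16. f i) = f 0 + f 1 + f 2 + f 3 + f 4 + f 5 + f 6 + f 7 +
      f 8 + f 9 + f 10 + f 11 + f 12 + f 13 + f 14 + f 15"
  by (simp_all add: eval_nat_numeral)

text \<open>The alternating sum of the five terms \<open>Z u + Z v\<close> around an odd cycle is twice one of the \<open>Z u\<close>.\<close>

lemma five_cycle_weight:
  fixes Z w1 w4 :: "nat \<Rightarrow> int"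
  assumes "\<And>i. \<bar>Z i + Z (i + 1)\<bar> \<le> w1 i" "\<And>i. \<bar>Z i + Z (i + 4)\<bar> \<le> w4 i"
  shows "2 * \<bar>Z i\<bar> \<le> w1 i + w1 (i + 1) + w1 (i + 2) + w1 (i + 3) + w4 i"
    and "2 * \<bar>Z (i + 4)\<bar> \<le> w1 i + w1 (i + 1) + w1 (i + 2) + w1 (i + 3) + w4 i"
  using assms(1)[of i] assms(1)[of "i + 1"] assms(1)[of "i + 2"] assms(1)[of "i + 3"] assms(2)[of i]
  by (simp_all add: eval_nat_numeral)

text \<open>The first bound yields expansion and uses one 5-cycle. The other two serve for edge
  faults: the weights with factor 2 are nonnegative, and a boundary between 0 and 1 is crossed by
  two edge-disjoint paths.\<close>

lemma weights8:
  fixes Z :: "nat \<Rightarrow> int"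
  assumes Z: "\<And>i. Z i \<in> {- 1, 0, 1}" "\<And>i. Z (i + 8) = Z i"
  defines "b \<equiv> (\<Sum>i<8. is_free (Z i) (Z (i + 1))) + (\<Sum>i<4. is_free (Z i) (Z (i + 4)))"
  shows "Z 0 = - 1 \<Longrightarrow> 1 \<le> b + (\<Sum>i<8. Z i)"
    and "\<bar>Z 0\<bar> \<noteq> \<bar>Z 1\<bar> \<Longrightarrow> 2 \<le> 2 * b + 3 * (\<Sum>i<8. Z i)"
    and "0 \<le> 2 * b + 3 * (\<Sum>i<8. Z i)"
proof -
  have per: "Z 8 = Z 0"
    using Z(2)[of 0] by simp
  \<comment> \<open>Every index lies in three summands: two along the cycle and one with offset
    4.\<close>
  have sum: "(\<Sum>i<8. c * is_free (Z i) (Z (i + 1)) + Z i + Z (i + 1)) +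
      (\<Sum>i<4. c * is_free (Z i) (Z (i + 4)) + Z i + Z (i + 4)) = c * b + 3 * (\<Sum>i<8. Z i)" for c
    unfolding b_def sum_lessThan_numerals using per by (simp add: distrib_left eval_nat_numeral)
  show "1 \<le> b + (\<Sum>i<8. Z i)" if Z0: "Z 0 = - 1"
  proof -
    define w1 where "w1 i = 2 * (3 * is_free (Z i) (Z (i + 1)) + Z i + Z (i + 1))" for i
    define w4 where "w4 i = 2 * (3 * is_free (Z i) (Z (i + 4)) + Z i + Z (i + 4))" for i
    have w: "\<bar>Z i + Z (i + 1)\<bar> \<le> w1 i" "\<bar>Z i + Z (i + 4)\<bar> \<le> w4 i" for i
      unfolding w1_def w4_def using is_free_weight3 Z(1) by (smt (verit))+
    have nonneg: "0 \<le> w1 i" "0 \<le> w4 i" for i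
      using w[of i] by linarith+
    \<comment> \<open>The cycle 0 1 2 3 4 contributes at least 2. As the total is 6 times the
      integer in question, that integer is at least 1.\<close>
    have "2 * \<bar>Z 0\<bar> \<le> w1 0 + w1 1 + w1 2 + w1 3 + w4 0"
      using five_cycle_weight(1)[of Z w1 w4 0] w by (simp add: numeral_2_eq_2)
    also have "\<dots> \<le> (\<Sum>i<8. w1 i) + (\<Sum>i<4. w4 i)"
      unfolding sum_lessThan_numerals
      using nonneg(1)[of 4] nonneg(1)[of 5] nonneg(1)[of 6] nonneg(1)[of 7]
        nonneg(2)[of 1] nonneg(2)[of 2] nonneg(2)[of 3] by linarith
    also have "\<dots> = 2 * (3 * b + 3 * (\<Sum>i<8. Z i))"
      unfolding w1_def w4_def sum_distrib_left[symmetric] distrib_left[symmetric] sum ..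
    finally show ?thesis using Z0 by simp
  qed
  define v1 where "v1 i = 2 * is_free (Z i) (Z (i + 1)) + Z i + Z (i + 1)" for i
  define v4 where "v4 i = 2 * is_free (Z i) (Z (i + 4)) + Z i + Z (i + 4)" for i
  have v: "\<bar>\<bar>Z i\<bar> - \<bar>Z (i + 1)\<bar>\<bar> \<le> v1 i" "\<bar>\<bar>Z i\<bar> - \<bar>Z (i + 4)\<bar>\<bar> \<le> v4 i" for i
    unfolding v1_def v4_def using is_free_weight2 Z(1) by blast+
  have nonneg: "0 \<le> v1 i" "0 \<le> v4 i" for i
    using v[of i] by linarith+
  have sumv: "(\<Sum>i<8. v1 i) + (\<Sum>i<4. v4 i) = 2 * b + 3 * (\<Sum>i<8. Z i)"
    unfolding v1_def v4_def by (rule sum)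
  show "0 \<le> 2 * b + 3 * (\<Sum>i<8. Z i)"
    unfolding sumv[symmetric] using nonneg by (intro add_nonneg_nonneg sum_nonneg) auto
  show "2 \<le> 2 * b + 3 * (\<Sum>i<8. Z i)" if ne: "\<bar>Z 0\<bar> \<noteq> \<bar>Z 1\<bar>"
  proof -
    \<comment> \<open>\<open>q\<close> separates 0 from 1, so both the edge 0 1 and the path 0 4 5 1
      have a crossing edge.\<close>
    define q where "q i = \<bar>Z i\<bar>" for i
    have "\<bar>q 0 - q 1\<bar> \<le> v1 0"
      "\<bar>q 1 - q 5\<bar> \<le> v4 1" "\<bar>q 4 - q 5\<bar> \<le> v1 4" "\<bar>q 0 - q 4\<bar> \<le> v4 0"
      using v(1)[of 0] v(2)[of 1] v(1)[of 4] v(2)[of 0] by (simp_all add: q_def)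
    moreover have "1 \<le> \<bar>q 0 - q 1\<bar>" using ne by (simp add: q_def)
    ultimately have "1 \<le> v1 0" "1 \<le> v4 1 + v1 4 + v4 0"
      by linarith+
    then have "2 \<le> (\<Sum>i<8. v1 i) + (\<Sum>i<4. v4 i)"
      unfolding sum_lessThan_numerals
      using nonneg(1)[of 1] nonneg(1)[of 2] nonneg(1)[of 3] nonneg(1)[of 5] nonneg(1)[of 6] nonneg(1)[of 7]
        nonneg(2)[of 2] nonneg(2)[of 3] by linarith
    then show ?thesis by (simp only: sumv)
  qed
qed

lemma weights16:
  fixes Z :: "nat \<Rightarrow> int"
  assumes Z: "\<And>i. Z i \<in> {- 1, 0, 1}" "\<And>i. Z (i + 16) = Z i"
  defines "b \<equiv> (\<Sum>i<16. is_free (Z i) (Z (i + 1))) + (\<Sum>i<16. is_free (Z i) (Z (i + 4)))"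
  shows "Z 0 = - 1 \<Longrightarrow> 2 \<le> b + (\<Sum>i<16. Z i)"
    and "\<bar>Z 0\<bar> \<noteq> \<bar>Z 1\<bar> \<Longrightarrow> 4 \<le> 2 * b + 4 * (\<Sum>i<16. Z i)"
    and "0 \<le> 2 * b + 4 * (\<Sum>i<16. Z i)"
proof -
  have per: "Z 16 = Z 0" "Z 17 = Z 1" "Z 18 = Z 2" "Z 19 = Z 3"
    using Z(2)[of 0] Z(2)[of 1] Z(2)[of 2] Z(2)[of 3] by simp_all
  have sum: "(\<Sum>i<16. c * is_free (Z i) (Z (i + 1)) + Z i + Z (i + 1)) +
      (\<Sum>i<16. c * is_free (Z i) (Z (i + 4)) + Z i + Z (i + 4)) = c * b + 4 * (\<Sum>i<16. Z i)" for c
    unfolding b_def sum_lessThan_numerals using per by (simp add: distrib_left eval_nat_numeral)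
  show "2 \<le> b + (\<Sum>i<16. Z i)" if Z0: "Z 0 = - 1"
  proof -
    define w1 where "w1 i = 4 * is_free (Z i) (Z (i + 1)) + Z i + Z (i + 1)" for i
    define w4 where "w4 i = 4 * is_free (Z i) (Z (i + 4)) + Z i + Z (i + 4)" for i
    have w: "\<bar>Z i + Z (i + 1)\<bar> \<le> w1 i" "\<bar>Z i + Z (i + 4)\<bar> \<le> w4 i" for i
      unfolding w1_def w4_def using is_free_weight4 Z(1) by blast+
    have nonneg: "0 \<le> w1 i" "0 \<le> w4 i" for i
      using w[of i] by linarith+
    \<comment> \<open>Three edge-disjoint 5-cycles, starting at 0, 4 and 12. The last one ends at
      16, which is 0 again.\<close>
    have blocks: "2 \<le> w1 0 + w1 1 + w1 2 + w1 3 + w4 0"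
      "2 * \<bar>Z 4\<bar> \<le> w1 4 + w1 5 + w1 6 + w1 7 + w4 4"
      "2 \<le> w1 12 + w1 13 + w1 14 + w1 15 + w4 12"
      using five_cycle_weight(1)[of Z w1 w4 0] five_cycle_weight(1)[of Z w1 w4 4]
        five_cycle_weight(2)[of Z w1 w4 12] w Z0 per by (simp_all add: numeral_2_eq_2)
    \<comment> \<open>The total is 4 times the integer in question, so 6 suffices for the bound 2.
      The two cycles through 0 give only 4, and the rest depends on the mark of 4.\<close>
    have "6 \<le> (w1 0 + w1 1 + w1 2 + w1 3 + w4 0) + (w1 4 + w1 5 + w1 6 + w1 7 + w4 4) +
        (w1 12 + w1 13 + w1 14 + w1 15 + w4 12)"
    proof (cases "Z 4 = 0")
      case True
      \<comment> \<open>Now the edge 0 4 is free and has weight 3. The alternating sum along the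
        path 0 1 2 3 4 is \<open>Z 0 - Z 4\<close>, so the path adds 1 and the first block reaches
        4.\<close>
      then have "w4 0 = 3"
        using Z0 by (simp add: w4_def is_free_def)
      moreover have "1 \<le> w1 0 + w1 1 + w1 2 + w1 3"
        using w(1)[of 0] w(1)[of 1] w(1)[of 2] w(1)[of 3] Z0 True by (simp add: eval_nat_numeral)
      ultimately show ?thesis using blocks True by linarith
    next
      case False
      then show ?thesis using blocks by linarith
    qed
    also have "\<dots> \<le> (\<Sum>i<16. w1 i) + (\<Sum>i<16. w4 i)"
      unfolding sum_lessThan_numerals
      using nonneg(1)[of 8] nonneg(1)[of 9] nonneg(1)[of 10] nonneg(1)[of 11]
        nonneg(2)[of 1] nonneg(2)[of 2] nonneg(2)[of 3] nonneg(2)[of 5] nonneg(2)[of 6] nonneg(2)[of 7]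
        nonneg(2)[of 8] nonneg(2)[of 9] nonneg(2)[of 10] nonneg(2)[of 11]
        nonneg(2)[of 13] nonneg(2)[of 14] nonneg(2)[of 15] by linarith
    also have "\<dots> = 4 * b + 4 * (\<Sum>i<16. Z i)"
      unfolding w1_def w4_def by (rule sum)
    finally show ?thesis by simp
  qed
  define v1 where "v1 i = 2 * is_free (Z i) (Z (i + 1)) + Z i + Z (i + 1)" for i
  define v4 where "v4 i = 2 * is_free (Z i) (Z (i + 4)) + Z i + Z (i + 4)" for i
  have v: "\<bar>\<bar>Z i\<bar> - \<bar>Z (i + 1)\<bar>\<bar> \<le> v1 i" "\<bar>\<bar>Z i\<bar> - \<bar>Z (i + 4)\<bar>\<bar> \<le> v4 i" for i
    unfolding v1_def v4_def using is_free_weight2 Z(1) by blast+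
  have nonneg: "0 \<le> v1 i" "0 \<le> v4 i" for i
    using v[of i] by linarith+
  have sumv: "(\<Sum>i<16. v1 i) + (\<Sum>i<16. v4 i) = 2 * b + 4 * (\<Sum>i<16. Z i)"
    unfolding v1_def v4_def by (rule sum)
  show "0 \<le> 2 * b + 4 * (\<Sum>i<16. Z i)"
    unfolding sumv[symmetric] using nonneg by (intro add_nonneg_nonneg sum_nonneg) auto
  show "4 \<le> 2 * b + 4 * (\<Sum>i<16. Z i)" if ne: "\<bar>Z 0\<bar> \<noteq> \<bar>Z 1\<bar>"
  proof -
    define q where "q i = \<bar>Z i\<bar>" for i
    have vq: "\<bar>q i - q (i + 1)\<bar> \<le> v1 i" "\<bar>q i - q (i + 4)\<bar> \<le> v4 i" for i
      using v[of i] by (simp_all add: q_def)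
    have per_q: "q 16 = q 0" "q 17 = q 1" "q 18 = q 2"
      using per by (simp_all add: q_def)
    \<comment> \<open>Four edge-disjoint paths between the vertices 0 and 1: 0 1, 0 4 5 1, 0 12 13 1, 0 15 14 2 1.\<close>
    have path1: "\<bar>q 0 - q 1\<bar> \<le> v1 0"
      using vq(1)[of 0] by simp
    have path2: "\<bar>q 1 - q 5\<bar> \<le> v4 1" "\<bar>q 4 - q 5\<bar> \<le> v1 4" "\<bar>q 0 - q 4\<bar> \<le> v4 0"
      using vq(2)[of 1] vq(1)[of 4] vq(2)[of 0] by simp_all
    have path3: "\<bar>q 13 - q 1\<bar> \<le> v4 13" "\<bar>q 12 - q 13\<bar> \<le> v1 12" "\<bar>q 12 - q 0\<bar> \<le> v4 12"
      using vq(2)[of 13] vq(1)[of 12] vq(2)[of 12] by (simp_all add: per_q)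
    have path4: "\<bar>q 1 - q 2\<bar> \<le> v1 1" "\<bar>q 14 - q 2\<bar> \<le> v4 14" "\<bar>q 14 - q 15\<bar> \<le> v1 14"
        "\<bar>q 15 - q 0\<bar> \<le> v1 15"
      using vq(1)[of 1] vq(2)[of 14] vq(1)[of 14] vq(1)[of 15] by (simp_all add: per_q numeral_2_eq_2)
    have lt: "q 0 < q 1 \<or> q 1 < q 0" using ne by (auto simp: q_def)
    have "1 \<le> v1 0"
      using lt path1[unfolded abs_le_iff] by linarith
    moreover have "1 \<le> v4 1 + v1 4 + v4 0"
      using lt path2[unfolded abs_le_iff] by linarith
    moreover have "1 \<le> v4 13 + v1 12 + v4 12"
      using lt path3[unfolded abs_le_iff] by linarith
    moreover have "1 \<le> v1 1 + v4 14 + v1 14 + v1 15"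
      using lt path4[unfolded abs_le_iff] by linarith
    ultimately have "4 \<le> (\<Sum>i<16. v1 i) + (\<Sum>i<16. v4 i)"
      unfolding sum_lessThan_numerals
      using nonneg(1)[of 2] nonneg(1)[of 3] nonneg(1)[of 5] nonneg(1)[of 6] nonneg(1)[of 7] nonneg(1)[of 8]
        nonneg(1)[of 9] nonneg(1)[of 10] nonneg(1)[of 11] nonneg(1)[of 13]
        nonneg(2)[of 2] nonneg(2)[of 3] nonneg(2)[of 4] nonneg(2)[of 5] nonneg(2)[of 6] nonneg(2)[of 7]
        nonneg(2)[of 8] nonneg(2)[of 9] nonneg(2)[of 10] nonneg(2)[of 11] nonneg(2)[of 15] by linarith
    then show ?thesis by (simp only: sumv)
  qed
qed

section \<open>Expansion and edge faults for n = 3 and n = 4\<close>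

lemma expanding_3: "expanding 3 1"
  unfolding expanding_def
proof (intro allI impI, elim conjE)
  fix S U assume SU: "S \<subseteq> circ_verts 3" "U \<subseteq> circ_verts 3" "S \<inter> U = {}" and "S \<noteq> {}"
  then obtain x where x: "x \<in> S" by blast
  define Z where "Z i = mark S U ((x + int i) mod 2 ^ 3)" for i
  have Z0: "Z 0 = - 1"
    using x SU by (auto simp: Z_def mark_def)
  have "1 \<le> (\<Sum>i<8. is_free (Z i) (Z (i + 1))) + (\<Sum>i<4. is_free (Z i) (Z (i + 4))) + (\<Sum>i<8. Z i)"
    using base_sums(3)[OF SU, of 4 x] mark_values Z0 by (intro weights8(1)) (simp_all add: Z_def)
  then show "card S + 1 \<le> card U + card (free_edges (rec_circulant 3) S U)"
    using base_sums(1,2)[OF SU, of 4 x] by (simp add: Z_def)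
qed

lemma expanding_4: "expanding 4 2"
  unfolding expanding_def
proof (intro allI impI, elim conjE)
  fix S U assume SU: "S \<subseteq> circ_verts 4" "U \<subseteq> circ_verts 4" "S \<inter> U = {}" and "S \<noteq> {}"
  then obtain x where x: "x \<in> S" by blast
  define Z where "Z i = mark S U ((x + int i) mod 2 ^ 4)" for i
  have Z0: "Z 0 = - 1"
    using x SU by (auto simp: Z_def mark_def)
  have "2 \<le> (\<Sum>i<16. is_free (Z i) (Z (i + 1))) + (\<Sum>i<16. is_free (Z i) (Z (i + 4))) + (\<Sum>i<16. Z i)"
    using base_sums(3)[OF SU, of 16 x] mark_values Z0 by (intro weights16(1)) (simp_all add: Z_def)
  then show "card S + 2 \<le> card U + card (free_edges (rec_circulant 4) S U)"
    using base_sums(1,2)[OF SU, of 16 x] by (simp add: Z_def)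
qed

lemma successor_closed_eq_circ_verts:
  assumes X: "X \<subseteq> circ_verts n" "X \<noteq> {}" and closed: "\<And>x. x \<in> X \<Longrightarrow> (x + 1) mod 2 ^ n \<in> X"
  shows "X = circ_verts n"
proof -
  obtain x where x: "x \<in> X" using X(2) by blast
  have "(x + int i) mod 2 ^ n \<in> X" for i
  proof (induction i)
    case 0
    then show ?case using x X(1) by (auto simp: subset_iff)
  next
    case (Suc i)
    then show ?case
      using closed[of "(x + int i) mod 2 ^ n"] by (simp add: mod_simps ac_simps)
  qed
  then have "(\<lambda>i. (x + int i) mod 2 ^ n) ` {..<2 ^ n} \<subseteq> X" by auto
  then show ?thesis
    using X(1) bij_betw_rotation[of x n] by (simp add: bij_betw_def)
qed

text \<open>Let \<open>f\<close> be the number of free edges and \<open>d = card U - card S\<close>.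
  If \<open>S \<union> U\<close> is everything, \<open>d\<close> is even, so
  \<open>d \<le> - 2\<close> and \<open>2 * f + n * d \<ge> 0\<close> suffices. Otherwise the
  boundary of \<open>S \<union> U\<close> raises the bound 0 to \<open>2 * n - 4\<close>, which is 2
  or 4, and \<open>d \<le> - 1\<close> gives \<open>2 * f \<ge> 3 * n - 4\<close>, enough for these
  \<open>n\<close> after rounding.\<close>

lemma free_edges_ge_degree_base:
  assumes n: "n = 3 \<or> n = 4"
    and SU: "S \<subseteq> circ_verts n" "U \<subseteq> circ_verts n" "S \<inter> U = {}" "card U < card S"
  shows "n \<le> card (free_edges (rec_circulant n) S U)"
proof -
  let ?f = "int (card (free_edges (rec_circulant n) S U))"
  let ?d = "int (card U) - int (card S)"
  have weights: "0 \<le> 2 * ?f + int n * ?d"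
    "\<bar>mark S U (x mod 2 ^ n)\<bar> \<noteq> \<bar>mark S U ((x + 1) mod 2 ^ n)\<bar> \<Longrightarrow> 2 * int n - 4 \<le> 2 * ?f + int n * ?d" for x
  proof -
    define Z where "Z i = mark S U ((x + int i) mod 2 ^ n)" for i
    define M :: nat where "M = (if n = 3 then 4 else 16)"
    define b where "b = (\<Sum>i<2 ^ n. is_free (Z i) (Z (i + 1))) + (\<Sum>i<M. is_free (Z i) (Z (i + 4)))"
    have nM: "n = 3 \<and> M = 4 \<or> n = 4 \<and> M = 16"
      using n by (auto simp: M_def)
    have b: "b \<le> ?f" "(\<Sum>i<2 ^ n. Z i) = ?d" and per: "Z (i + 2 ^ n) = Z i" for i
      using base_sums[OF SU(1-3) nM, of x] unfolding Z_def b_def by blast+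
    have val: "Z i \<in> {- 1, 0, 1}" for i
      using mark_values by (simp add: Z_def)
    have "0 \<le> 2 * b + int n * ?d \<and> (\<bar>Z 0\<bar> \<noteq> \<bar>Z 1\<bar> \<longrightarrow> 2 * int n - 4 \<le> 2 * b + int n * ?d)"
      using nM
    proof (elim disjE conjE)
      assume "n = 3" "M = 4"
      then show ?thesis
        using weights8(2,3)[of Z] val per b(2) by (simp add: b_def)
    next
      assume "n = 4" "M = 16"
      then show ?thesis
        using weights16(2,3)[of Z] val per b(2) by (simp add: b_def)
    qed
    then show "0 \<le> 2 * ?f + int n * ?d"
      "\<bar>mark S U (x mod 2 ^ n)\<bar> \<noteq> \<bar>mark S U ((x + 1) mod 2 ^ n)\<bar> \<Longrightarrow> 2 * int n - 4 \<le> 2 * ?f + int n * ?d"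
      using b(1) by (auto simp: Z_def)
  qed
  have abs_mark: "\<bar>mark S U x\<bar> = of_bool (x \<in> S \<union> U)" for x
    by (simp add: mark_def)
  have fin: "finite S" "finite U"
    using SU finite_subset[OF _ finite_atLeastAtMost_int] by blast+
  show ?thesis
  proof (cases "\<forall>x\<in>S \<union> U. (x + 1) mod 2 ^ n \<in> S \<union> U")
    case True
    have "S \<union> U = circ_verts n"
      using SU True by (intro successor_closed_eq_circ_verts) auto
    then have "card S + card U = 2 ^ n"
      using card_Un_disjoint[OF fin SU(3)] by (simp add: nat_power_eq)
    then have "even (card S + card U)" using n by auto
    then have "?d \<le> - 2" using SU(4) by presburger
    then show ?thesis using weights(1) n by auto
  next
    case False
    then obtain x where x: "x \<in> S \<union> U" "(x + 1) mod 2 ^ n \<notin> S \<union> U" by blast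
    then have "x mod 2 ^ n = x" using SU by (auto simp: subset_iff)
    then have "2 * int n - 4 \<le> 2 * ?f + int n * ?d"
      using x by (intro weights(2)[of x]) (simp add: abs_mark)
    moreover have "?d \<le> - 1" using SU(4) by simp
    ultimately show ?thesis using n by auto
  qed
qed

section \<open>Deletion numbers\<close>

lemma card_sum_split:
  assumes "finite F"
  shows "card F = card (Inl -` F) + card (Inr -` F)"
proof -
  have "F = (Inl -` F) <+> (Inr -` F)"
    by (auto simp: Plus_def image_iff) (metis sum.exhaust)
  moreover have "finite (Inl -` F)" "finite (Inr -` F)"
    using assms by (auto intro: finite_vimageI)
  ultimately show ?thesis by (metis card_Plus)
qed

lemma expanding_card_faults:
  assumes "expanding n k" "finite F" "F \<subseteq> verts (rec_circulant n) <+> edges (rec_circulant n)"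
    "\<not> has_fpm (delete_elems (rec_circulant n) F)"
  shows "k < card F"
proof -
  obtain S U where SU: "S \<subseteq> circ_verts n" "U \<subseteq> circ_verts n" "S \<inter> U = {}" "S \<noteq> {}"
    and less: "card U < card S + card (Inl -` F)"
    and free: "free_edges (rec_circulant n) S U \<subseteq> Inr -` F"
    using no_fpm_obtain_barrier[OF simple_graph_rec_circulant assms(3,4)] by auto
  have "card S + k \<le> card U + card (free_edges (rec_circulant n) S U)"
    using assms(1) SU unfolding expanding_def by blast
  moreover have "card (free_edges (rec_circulant n) S U) \<le> card (Inr -` F)"
    using assms(2) by (intro card_mono[OF _ free]) (auto intro: finite_vimageI)
  ultimately show ?thesis
    using less card_sum_split[OF assms(2)] by linarith
qed

text \<open>Both starting values are \<open>n - 2\<close>. A step adds 3 to the surplus while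
  \<open>n\<close> grows by 2, so a single step reaches \<open>n - 1\<close>, and from then on the
  cap keeps it there.\<close>

lemma expanding_rec_circulant: "n \<ge> 5 \<Longrightarrow> expanding n (n - 1)"
proof (induction n rule: less_induct)
  case (less n)
  consider "n = 5" | "n = 6" | "n \<ge> 7" using less.prems by linarith
  then show ?case
  proof cases
    case 1
    then show ?thesis using expanding_step[OF expanding_3] by simp
  next
    case 2
    then show ?thesis using expanding_step[OF expanding_4] by simp
  next
    case 3
    then have "expanding (n - 2) (n - 3)"
      using less.IH[of "n - 2"] by (simp add: numeral_eq_Suc)
    moreover have "n - 2 + 2 = n" "min (n - 3 + 3) (n - 2 + 1) = n - 1"
      using 3 by linarith+
    ultimately show ?thesis
      using expanding_step[of "n - 2" "n - 3"] 3 by simp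
  qed
qed

section \<open>Fault sets that attain the bounds\<close>

lemma fsmp_eqI:
  assumes "finite F" "F \<subseteq> verts G <+> edges G" "\<not> has_fpm (delete_elems G F)" "card F \<le> k"
    and "\<And>F. finite F \<Longrightarrow> F \<subseteq> verts G <+> edges G \<Longrightarrow> \<not> has_fpm (delete_elems G F) \<Longrightarrow> k \<le> card F"
  shows "fsmp G = k"
  unfolding fsmp_def
proof (rule Least_equality)
  have "card F = k" using assms by (simp add: order_antisym)
  then show "\<exists>F. finite F \<and> F \<subseteq> verts G <+> edges G \<and> card F = k \<and> \<not> has_fpm (delete_elems G F)"
    using assms(1-3) by blast
qed (use assms(5) in blast)

lemma fmp_eqI:
  assumes "finite F" "F \<subseteq> edges G" "\<not> has_fpm (delete_edges G F)" "card F \<le> k"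
    and "\<And>F. finite F \<Longrightarrow> F \<subseteq> edges G \<Longrightarrow> \<not> has_fpm (delete_edges G F) \<Longrightarrow> k \<le> card F"
  shows "fmp G = k"
  unfolding fmp_def
proof (rule Least_equality)
  have "card F = k" using assms by (simp add: order_antisym)
  then show "\<exists>F. finite F \<and> F \<subseteq> edges G \<and> card F = k \<and> \<not> has_fpm (delete_edges G F)"
    using assms(1-3) by blast
qed (use assms(5) in blast)

text \<open>Disjointness makes \<open>S\<close> independent, so every edge meeting \<open>S\<close>
  has one end in \<open>S\<close> and the other in \<open>T\<close>; the weights then force
  \<open>card S \<le> card T\<close>.\<close>

lemma barrier_no_fpm:
  assumes G: "simple_graph G" and ST: "S \<subseteq> verts G" "T \<subseteq> verts G" "S \<inter> T = {}" "card T < card S"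
    and nbrs: "\<And>u v. {u, v} \<in> edges G \<Longrightarrow> u \<in> S \<Longrightarrow> v \<in> T"
  shows "\<not> has_fpm G"
proof
  assume "has_fpm G"
  then have "card S \<le> card T"
  proof (rule has_fpm_card_le[OF G _ ST(1,2)])
    fix e assume e: "e \<in> edges G"
    show "card (e \<inter> S) \<le> card (e \<inter> T)"
    proof (cases "e \<inter> S = {}")
      case False
      then obtain u where u: "u \<in> e" "u \<in> S" by blast
      have "card e = 2" using G e by (simp add: simple_graph_def)
      then obtain v where v: "e = {u, v}"
        using u(1) by (metis card_2_iff doubleton_eq_iff insertE singletonD)
      then have "v \<in> T" using nbrs e u(2) by blast
      then have "e \<inter> S = {u}" "v \<in> e \<inter> T" "finite (e \<inter> T)"
        using u v ST(3) by auto
      then show ?thesis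
        by (metis card_gt_0_iff empty_iff Suc_leI card_1_singleton_iff One_nat_def)
    qed simp
  qed
  with ST(4) show False by simp
qed

lemma card_edges_at_0:
  "card {e \<in> edges (rec_circulant n). 0 \<in> e} \<le> n"
proof -
  define A where "A = (\<lambda>i. 4 ^ i :: int) ` {..<(n + 1) div 2}"
  \<comment> \<open>For odd \<open>n\<close> the largest power \<open>4 ^ i\<close> is
    \<open>2 ^ (n - 1)\<close>, its own negative modulo \<open>2 ^ n\<close>. \<open>B\<close>
    leaves it out, which makes the total \<open>n\<close> for both parities.\<close>
  define B where "B = (\<lambda>i. 2 ^ n - 4 ^ i :: int) ` {..<n div 2}"
  have nbr: "v \<in> A \<union> B" if v: "v \<in> circ_verts n" and i: "2 * i < n"
    and c: "[v = 4 ^ i] (mod 2 ^ n) \<or> [v = - (4 ^ i)] (mod 2 ^ n)" for v i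
  proof -
    have lt: "(4 :: int) ^ i < 2 ^ n"
      using i power_strict_increasing[of "2 * i" n "2 :: int"] by (simp add: power_mult)
    from c show ?thesis
    proof
      assume "[v = 4 ^ i] (mod 2 ^ n)"
      then have "v = 4 ^ i" using v lt by (auto simp: cong_def)
      then show ?thesis using i by (auto simp: A_def)
    next
      assume "[v = - (4 ^ i)] (mod 2 ^ n)"
      then have "[v = 2 ^ n - 4 ^ i] (mod 2 ^ n)"
        by (simp add: cong_iff_dvd_diff algebra_simps dvd_add_right_iff)
      then have v: "v = 2 ^ n - 4 ^ i" using v lt by (intro cong_less_imp_eq_int) auto
      show ?thesis
      proof (cases "i < n div 2")
        case True
        then show ?thesis using v by (auto simp: B_def)
      next
        case False
        then have "n = Suc (2 * i)" using i by linarith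
        then have "v = 4 ^ i" using v by (simp add: power_mult)
        then show ?thesis using i by (auto simp: A_def)
      qed
    qed
  qed
  have "{e \<in> edges (rec_circulant n). 0 \<in> e} \<subseteq> (\<lambda>v. {0, v}) ` (A \<union> B)"
  proof
    fix e assume e: "e \<in> {e \<in> edges (rec_circulant n). 0 \<in> e}"
    then obtain u w where uw: "e = {u, w}" "u \<in> circ_verts n" "w \<in> circ_verts n" "rec_circulant_adj n u w"
      by (auto simp: rec_circulant_def)
    obtain i where i: "2 * i < n" "[u - w = 4 ^ i] (mod 2 ^ n) \<or> [u - w = - (4 ^ i)] (mod 2 ^ n)"
      using uw(4) by (auto simp: rec_circulant_adj_iff)
    consider "u = 0" | "w = 0" using e uw(1) by auto
    then show "e \<in> (\<lambda>v. {0, v}) ` (A \<union> B)"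
    proof cases
      case 1
      then have "[w = 4 ^ i] (mod 2 ^ n) \<or> [w = - (4 ^ i)] (mod 2 ^ n)"
        using i(2) cong_minus_minus_iff[of "- w" "4 ^ i" "2 ^ n"] cong_minus_minus_iff[of w "4 ^ i" "2 ^ n"] by auto
      then show ?thesis using nbr[OF uw(3) i(1)] uw(1) 1 by auto
    next
      case 2
      then show ?thesis using nbr[OF uw(2) i(1)] i(2) uw(1) by auto
    qed
  qed
  then have "card {e \<in> edges (rec_circulant n). 0 \<in> e} \<le> card (A \<union> B)"
    by (rule surj_card_le[rotated]) (simp add: A_def B_def)
  also have "\<dots> \<le> card A + card B" by (rule card_Un_le)
  also have "\<dots> \<le> (n + 1) div 2 + n div 2"
    unfolding A_def B_def by (intro add_mono) (metis card_image_le card_lessThan finite_lessThan)+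
  also have "\<dots> = n" by linarith
  finally show ?thesis .
qed

text \<open>Deleting all edges at the vertex 0 isolates it.\<close>

lemma isolating_faults:
  obtains F where "finite F" "F \<subseteq> edges (rec_circulant n)" "card F \<le> n"
    "\<not> has_fpm (delete_edges (rec_circulant n) F)"
proof (rule that)
  let ?F = "{e \<in> edges (rec_circulant n). 0 \<in> e}"
  show "card ?F \<le> n" by (rule card_edges_at_0)
  show "finite ?F"
    using simple_graph_finite_edges[OF simple_graph_rec_circulant] by simp
  show "\<not> has_fpm (delete_edges (rec_circulant n) ?F)"
    unfolding delete_edges_eq_delete_elems
    by (rule barrier_no_fpm[OF simple_graph_delete_elems[OF simple_graph_rec_circulant],
          where S = "{0}" and T = "{}"]) (auto simp: delete_elems_def)
qed auto

text \<open>Adjacency as a residue condition, so that the barrier below can be checked by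
  evaluation.\<close>

lemma edge_rec_circulant_3D:
  assumes "{u, v} \<in> edges (rec_circulant 3)"
  shows "u \<in> {0..7}" "v \<in> {0..7}" "(u - v) mod 8 \<in> {1, 4, 7}"
proof -
  have adj: "(a - b) mod 8 \<in> {1, 4, 7}" "(b - a) mod 8 \<in> {1, 4, 7}" if "rec_circulant_adj 3 a b" for a b
  proof -
    obtain i where i: "2 * i < 3" "[a - b = 4 ^ i] (mod 8) \<or> [a - b = - (4 ^ i)] (mod 8)"
      using \<open>rec_circulant_adj 3 a b\<close> by (auto simp: rec_circulant_adj_iff)
    then consider "i = 0" | "i = 1" by linarith
    then have "(a - b) mod 8 = 1 \<or> (a - b) mod 8 = 4 \<or> (a - b) mod 8 = 7"
      using i(2) by cases (auto simp: cong_def)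
    then show "(a - b) mod 8 \<in> {1, 4, 7}" "(b - a) mod 8 \<in> {1, 4, 7}"
      using zmod_zminus1_eq_if[of "a - b" 8] by auto
  qed
  show "u \<in> {0..7}" "v \<in> {0..7}" "(u - v) mod 8 \<in> {1, 4, 7}"
    using assms adj by (auto simp: rec_circulant_def doubleton_eq_iff)
qed

lemma edge_rec_circulant_4D:
  assumes "{u, v} \<in> edges (rec_circulant 4)"
  shows "u \<in> {0..15}" "v \<in> {0..15}" "(u - v) mod 16 \<in> {1, 4, 12, 15}"
proof -
  have adj: "(a - b) mod 16 \<in> {1, 4, 12, 15}" "(b - a) mod 16 \<in> {1, 4, 12, 15}" if "rec_circulant_adj 4 a b" for a b
  proof -
    obtain i where i: "2 * i < 4" "[a - b = 4 ^ i] (mod 16) \<or> [a - b = - (4 ^ i)] (mod 16)"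
      using \<open>rec_circulant_adj 4 a b\<close> by (auto simp: rec_circulant_adj_iff)
    then consider "i = 0" | "i = 1" by linarith
    then have "(a - b) mod 16 = 1 \<or> (a - b) mod 16 = 4 \<or> (a - b) mod 16 = 12 \<or> (a - b) mod 16 = 15"
      using i(2) by cases (auto simp: cong_def)
    then show "(a - b) mod 16 \<in> {1, 4, 12, 15}" "(b - a) mod 16 \<in> {1, 4, 12, 15}"
      using zmod_zminus1_eq_if[of "a - b" 16] by auto
  qed
  show "u \<in> {0..15}" "v \<in> {0..15}" "(u - v) mod 16 \<in> {1, 4, 12, 15}"
    using assms adj by (auto simp: rec_circulant_def doubleton_eq_iff)
qed

lemma fsmp_rec_circulant_3: "fsmp (rec_circulant 3) = 2"
proof (rule fsmp_eqI)
  let ?F = "{Inl 2, Inr {0, 1}} :: (int + int set) set"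
  \<comment> \<open>Without the vertex 2, the only edge inside \<open>?S\<close> is
    \<open>{0, 1}\<close>. Once it is deleted, \<open>?S\<close> is independent, with four vertices
    against the three that remain.\<close>
  let ?S = "{0, 1, 3, 6} :: int set"
  let ?T = "{4, 5, 7} :: int set"
  show "?F \<subseteq> verts (rec_circulant 3) <+> edges (rec_circulant 3)"
    using edge_shift_rec_circulant[of 0 3 0] by auto
  have nbrs: "\<forall>u\<in>?S. \<forall>v\<in>{0..7}. (u - v) mod 8 \<in> {1, 4, 7} \<and> v \<noteq> 2 \<and> {u, v} \<noteq> {0, 1} \<longrightarrow> v \<in> ?T"
    by code_simp
  show "\<not> has_fpm (delete_elems (rec_circulant 3) ?F)"
  proof (rule barrier_no_fpm[OF simple_graph_delete_elems[OF simple_graph_rec_circulant],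
        where S = ?S and T = ?T])
    fix u v assume e: "{u, v} \<in> edges (delete_elems (rec_circulant 3) ?F)" "u \<in> ?S"
    then have "{u, v} \<in> edges (rec_circulant 3)" "v \<noteq> 2" "{u, v} \<noteq> {0, 1}"
      by (auto simp: delete_elems_def)
    then show "v \<in> ?T"
      using nbrs e(2) edge_rec_circulant_3D[of u v] by blast
  qed (auto simp: delete_elems_def)
  show "2 \<le> card F" if "finite F" "F \<subseteq> verts (rec_circulant 3) <+> edges (rec_circulant 3)"
    "\<not> has_fpm (delete_elems (rec_circulant 3) F)" for F
    using expanding_card_faults[OF expanding_3 that] by simp
qed auto

lemma fsmp_rec_circulant_4: "fsmp (rec_circulant 4) = 3"
proof (rule fsmp_eqI)
  let ?F = "{Inl 0, Inr {1, 2}, Inr {9, 10}} :: (int + int set) set"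
  \<comment> \<open>Without the vertex 0, the only edges inside \<open>?S\<close> are the two
    deleted ones, so eight independent vertices face the seven in \<open>?T\<close>.\<close>
  let ?S = "{1, 2, 4, 7, 9, 10, 12, 15} :: int set"
  let ?T = "{3, 5, 6, 8, 11, 13, 14} :: int set"
  show "?F \<subseteq> verts (rec_circulant 4) <+> edges (rec_circulant 4)"
    using edge_shift_rec_circulant[of 1 4 0] edge_shift_rec_circulant[of 9 4 0] by auto
  have nbrs: "\<forall>u\<in>?S. \<forall>v\<in>{0..15}. (u - v) mod 16 \<in> {1, 4, 12, 15} \<and> v \<noteq> 0 \<and>
      {u, v} \<noteq> {1, 2} \<and> {u, v} \<noteq> {9, 10} \<longrightarrow> v \<in> ?T"
    by code_simp
  show "\<not> has_fpm (delete_elems (rec_circulant 4) ?F)"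
  proof (rule barrier_no_fpm[OF simple_graph_delete_elems[OF simple_graph_rec_circulant],
        where S = ?S and T = ?T])
    fix u v assume e: "{u, v} \<in> edges (delete_elems (rec_circulant 4) ?F)" "u \<in> ?S"
    then have "{u, v} \<in> edges (rec_circulant 4)" "v \<noteq> 0" "{u, v} \<noteq> {1, 2}" "{u, v} \<noteq> {9, 10}"
      by (auto simp: delete_elems_def)
    then show "v \<in> ?T"
      using nbrs e(2) edge_rec_circulant_4D[of u v] by blast
  qed (auto simp: delete_elems_def)
  show "3 \<le> card F" if "finite F" "F \<subseteq> verts (rec_circulant 4) <+> edges (rec_circulant 4)"
    "\<not> has_fpm (delete_elems (rec_circulant 4) F)" for F
    using expanding_card_faults[OF expanding_4 that] by simp
qed (auto simp: card_insert_if)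

lemma edge_faults_ge:
  assumes n: "n \<ge> 3" and F: "finite F" "F \<subseteq> edges (rec_circulant n)"
    "\<not> has_fpm (delete_edges (rec_circulant n) F)"
  shows "n \<le> card F"
proof -
  have F': "finite (Inr ` F)" "Inr ` F \<subseteq> verts (rec_circulant n) <+> edges (rec_circulant n)"
    "\<not> has_fpm (delete_elems (rec_circulant n) (Inr ` F))"
    using F by (auto simp: delete_edges_eq_delete_elems)
  have card: "card (Inr ` F :: (int + int set) set) = card F"
    by (simp add: card_image)
  show ?thesis
  proof (cases "n \<ge> 5")
    case True
    then show ?thesis
      using expanding_card_faults[OF expanding_rec_circulant F'] card by simp
  next
    case False
    obtain S U where SU: "S \<subseteq> circ_verts n" "U \<subseteq> circ_verts n" "S \<inter> U = {}"
      and less: "card U < card S + card (Inl -` (Inr ` F) :: int set)"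
      and free: "free_edges (rec_circulant n) S U \<subseteq> Inr -` (Inr ` F :: (int + int set) set)"
      by (rule no_fpm_obtain_barrier[OF simple_graph_rec_circulant F'(2,3), unfolded verts_rec_circulant]) blast
    have "(Inl -` (Inr ` F) :: int set) = {}" "Inr -` (Inr ` F :: (int + int set) set) = F"
      by auto
    then have "card U < card S" "free_edges (rec_circulant n) S U \<subseteq> F"
      using less free by simp_all
    \<comment> \<open>With no vertex deleted, the barrier has \<open>card U < card S\<close>, the
      case in which the base graphs have at least \<open>n\<close> free edges.\<close>
    moreover have "n = 3 \<or> n = 4" using n False by linarith
    ultimately have "n \<le> card (free_edges (rec_circulant n) S U)" "card (free_edges (rec_circulant n) S U) \<le> card F"
      using free_edges_ge_degree_base[OF _ SU] card_mono[OF F(1)] by blast+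
    then show ?thesis by linarith
  qed
qed

theorem theorem4p23:
  fixes n :: nat
  assumes "n \<ge> 3"
  shows "fmp (rec_circulant n) = n \<and>
         fsmp (rec_circulant n) = (if n \<in> {3, 4} then n - 1 else n)"
proof
  obtain F where F: "finite F" "F \<subseteq> edges (rec_circulant n)" "card F \<le> n"
    "\<not> has_fpm (delete_edges (rec_circulant n) F)"
    by (rule isolating_faults)
  show "fmp (rec_circulant n) = n"
    using F edge_faults_ge[OF assms] by (intro fmp_eqI[of F])
  show "fsmp (rec_circulant n) = (if n \<in> {3, 4} then n - 1 else n)"
  proof (cases "n \<in> {3, 4}")
    case True
    then show ?thesis using fsmp_rec_circulant_3 fsmp_rec_circulant_4 by auto
  next
    case False
    then have "expanding n (n - 1)"
      using assms by (intro expanding_rec_circulant) auto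
    then have ge: "n \<le> card F" if "finite F" "F \<subseteq> verts (rec_circulant n) <+> edges (rec_circulant n)"
      "\<not> has_fpm (delete_elems (rec_circulant n) F)" for F
      using expanding_card_faults[OF _ that] by fastforce
    \<comment> \<open>The edges at one vertex remain an optimal fault set when vertices may be
      deleted too.\<close>
    have "fsmp (rec_circulant n) = n"
      using F ge by (intro fsmp_eqI[of "Inr ` F"]) (auto simp: delete_edges_eq_delete_elems card_image)
    then show ?thesis using False by simp
  qed
qed

end
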